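(* Let $c\in\{0,1,-1\}$, $n\ge 2$, and let $Q_c^n$ denote the simply connected $n$-dimensional space form of constant sectional curvature $c$ (that is, $\mathbb{R}^n$, $\mathbb{S}^n$ or $\mathbb{H}^n$). There exists a two-parameter family $\{\Sigma(a,k)\,;\,a,k>0\}$ of properly embedded vertical helicoids in $Q_c^n\times\mathbb{R}$ whose horizontal sections are vertical translations of totally geodesic hypersurfaces of $Q_c^n$. Each such $\Sigma(a,k)$ is an $a$-pitched twisting of a totally geodesic hypersurface $\Sigma_0\subset Q_c^n$ determined by a suitable one-parameter subgroup $\mathscr{G}=\{\Gamma_s=\Gamma_s(k)\,;\,s\in\mathbb{R}\}$ of $\mathrm{Isom}(Q_c^n)$. Furthermore, for any fixed $a>0$, the parameter $k$ can be chosen in such a way that $\Sigma(a,k)$ contains open spacelike zero mean isocurved subsets.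
   Context: For a Riemannian manifold $M$, $M\times\mathbb{R}$ carries the product metric $\langle\,,\rangle=\langle\,,\rangle_M+dt^2$ with Levi-Civita connection $\overline\nabla$; $\partial_t$ is the unit vertical field. For an orientable hypersurface $\Sigma\subset M\times\mathbb{R}$ with unit normal $N$: the shape operator is $AX=-\overline\nabla_XN$; the mean curvature is $H=\mathrm{trace}\,A$ (not normalized); $\xi$ is the restriction to $\Sigma$ of the projection onto $\mathbb{R}$, with gradient $\nabla\xi$ on $\Sigma$; $\Theta=\langle N,\partial_t\rangle$ is the angle function. A horizontal point is a point where $\Theta^2=1$ (a critical point of $\xi$). A horizontal section of $\Sigma$ is $\Sigma_t=\Sigma\cap(M\times\{t\})$ when the intersection is transversal. Vertical helicoid: a hypersurface with no horizontal points and nonconstant angle function whose horizontal sections $\Sigma_t$ are minimal hypersurfaces of $M\times\{t\}$ and such that $\langle A\nabla\xi,\nabla\xi\rangle=0$ on $\Sigma$. Given a hypersurface $\Sigma_0\subset M$, a one-parameter group of isometries $\{\Gamma_s\,;\,s\in\mathbb{R}\}$ of $M$ ($\Gamma_0=\mathrm{id}$) and $a>0$, the $a$-pitched twisting of $\Sigma_0$ determined by $\{\Gamma_s\}$ is $\{(\Gamma_s(p),as)\in M\times\mathbb{R}\,;\,p\in\Sigma_0,\ s\in\mathbb{R}\}$. Lorentzian notions: $\langle\,,\rangle_L=\langle\,,\rangle_M-dt^2$. $\Sigma$ is spacelike if $\langle\,,\rangle_L$ is positive definite on $\Sigma$ (equivalently $2\Theta^2>1$). For spacelike $\Sigma$,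 put $N_L=\mu\,(N-2\Theta\partial_t)$ with $\mu=-1/\sqrt{2\Theta^2-1}$ (so $\langle N_L,N_L\rangle_L=-1$), $A_LX=-\overline\nabla_XN_L$, $H_L=-\mathrm{trace}\,A_L$. A spacelike $\Sigma$ is zero mean isocurved if $H=H_L=0$. *)

theory Defs
  imports "HOL-Analysis.Analysis"
begin

section \<open>Smooth maps\<close>

primrec Ck_on :: "nat \<Rightarrow> 'a::real_normed_vector set \<Rightarrow> ('a \<Rightarrow> 'b::real_normed_vector) \<Rightarrow> bool" where
  "Ck_on 0 U f \<longleftrightarrow> continuous_on U f"
| "Ck_on (Suc k) U f \<longleftrightarrow>
     f differentiable_on U \<and> (\<forall>v. Ck_on k U (\<lambda>x. frechet_derivative f (at x) v))"

definition smooth_on_open :: "'a::real_normed_vector set \<Rightarrow> ('a \<Rightarrow> 'b::real_normed_vector) \<Rightarrow> bool" where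
  "smooth_on_open U f \<longleftrightarrow> open U \<and> (\<forall>k. Ck_on k U f)"

text \<open>On an arbitrary subset of a Euclidean space (in particular on an embedded submanifold),
  smooth means locally the restriction of a smooth map defined on an open set.\<close>

definition smooth_map_on :: "'a::euclidean_space set \<Rightarrow> ('a \<Rightarrow> 'b::euclidean_space) \<Rightarrow> bool" where
  "smooth_map_on S f \<longleftrightarrow>
     (\<forall>p\<in>S. \<exists>U F. p \<in> U \<and> smooth_on_open U F \<and> (\<forall>x\<in>S \<inter> U. F x = f x))"

section \<open>Submanifolds of a Euclidean space with a constant bilinear form\<close>

text \<open>Throughout, \<open>W\<close> is an embedded submanifold of a Euclidean space \<open>'e\<close>, and its metric is the
  restriction to the tangent spaces of \<open>W\<close> of a constant symmetric bilinear form \<open>g\<close> on \<open>'e\<close>, which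
  is assumed positive definite on those tangent spaces only.\<close>

definition tangent_space :: "'e::euclidean_space set \<Rightarrow> 'e \<Rightarrow> 'e set" where
  "tangent_space S p = {v. \<exists>\<gamma> \<epsilon>. 0 < \<epsilon> \<and> smooth_on_open {-\<epsilon><..<\<epsilon>} \<gamma> \<and> \<gamma> ` {-\<epsilon><..<\<epsilon>} \<subseteq> S \<and>
     \<gamma> 0 = p \<and> (\<gamma> has_vector_derivative v) (at (0::real))}"

text \<open>Embedded hypersurfaces of \<open>W\<close>: locally, zero sets in \<open>W\<close> of smooth functions whose
  differential on the tangent space of \<open>W\<close> does not vanish.\<close>

definition hypersurface :: "'e::euclidean_space set \<Rightarrow> 'e set \<Rightarrow> bool" where
  "hypersurface W S \<longleftrightarrow> S \<subseteq> W \<and>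
     (\<forall>p\<in>S. \<exists>U (F :: 'e \<Rightarrow> real). p \<in> U \<and> smooth_on_open U F \<and>
        S \<inter> U = {x \<in> W \<inter> U. F x = 0} \<and>
        (\<forall>x\<in>S \<inter> U. \<exists>X\<in>tangent_space W x. frechet_derivative F (at x) X \<noteq> 0))"

definition properly_embedded :: "'e::euclidean_space set \<Rightarrow> 'e set \<Rightarrow> bool" where
  "properly_embedded W S \<longleftrightarrow>
     hypersurface W S \<and> proper_map (top_of_set S) (top_of_set W) id"

text \<open>\<open>levi_civita g W S Y p X\<close> is the covariant derivative at \<open>p\<close>, in the direction \<open>X\<close> tangent
  to \<open>S\<close>, of a field \<open>Y\<close> along \<open>S \<subseteq> W\<close> that is tangent to \<open>W\<close>, for the Levi-Civita connection of
  \<open>W\<close>: as \<open>g\<close> is constant, that connection is the part tangent to \<open>W\<close> of the derivative of \<open>Y\<close> in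
  \<open>'e\<close>. The Frechet derivative within \<open>S\<close> is only determined on vectors tangent to \<open>S\<close>, and is only
  used there.\<close>

definition levi_civita ::
    "('e::euclidean_space \<Rightarrow> 'e \<Rightarrow> real) \<Rightarrow> 'e set \<Rightarrow> 'e set \<Rightarrow> ('e \<Rightarrow> 'e) \<Rightarrow> 'e \<Rightarrow> 'e \<Rightarrow> 'e" where
  "levi_civita g W S Y p X =
     (THE w. w \<in> tangent_space W p \<and>
        (\<forall>Z\<in>tangent_space W p. g (frechet_derivative Y (at p within S) X - w) Z = 0))"

definition unit_normal ::
    "('e::euclidean_space \<Rightarrow> 'e \<Rightarrow> real) \<Rightarrow> 'e set \<Rightarrow> 'e set \<Rightarrow> ('e \<Rightarrow> 'e) \<Rightarrow> bool" where
  "unit_normal g W S N \<longleftrightarrow> smooth_map_on S N \<and>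
     (\<forall>p\<in>S. N p \<in> tangent_space W p \<and> g (N p) (N p) = 1 \<and> (\<forall>X\<in>tangent_space S p. g (N p) X = 0))"

definition shape_operator ::
    "('e::euclidean_space \<Rightarrow> 'e \<Rightarrow> real) \<Rightarrow> 'e set \<Rightarrow> 'e set \<Rightarrow> ('e \<Rightarrow> 'e) \<Rightarrow> 'e \<Rightarrow> 'e \<Rightarrow> 'e" where
  "shape_operator g W S N p X = - levi_civita g W S N p X"

text \<open>Trace of an endomorphism \<open>A\<close> of a subspace \<open>V\<close>, computed in any basis of \<open>V\<close>.\<close>

definition trace_on :: "'e::euclidean_space set \<Rightarrow> ('e \<Rightarrow> 'e) \<Rightarrow> real" where
  "trace_on V A =
     (let b = SOME b. independent b \<and> span b = V in \<Sum>e\<in>b. representation b (A e) e)"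

definition mean_curvature ::
    "('e::euclidean_space \<Rightarrow> 'e \<Rightarrow> real) \<Rightarrow> 'e set \<Rightarrow> 'e set \<Rightarrow> ('e \<Rightarrow> 'e) \<Rightarrow> 'e \<Rightarrow> real" where
  "mean_curvature g W S N p = trace_on (tangent_space S p) (shape_operator g W S N p)"

text \<open>The two notions below do not depend on the sign of the normal, so local unit normals
  suffice and orientability is not required.\<close>

definition minimal_hypersurface ::
    "('e::euclidean_space \<Rightarrow> 'e \<Rightarrow> real) \<Rightarrow> 'e set \<Rightarrow> 'e set \<Rightarrow> bool" where
  "minimal_hypersurface g W S \<longleftrightarrow> hypersurface W S \<and>
     (\<forall>V N. openin (top_of_set S) V \<and> unit_normal g W V N \<longrightarrow>
        (\<forall>p\<in>V. mean_curvature g W V N p = 0))"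

definition totally_geodesic_hypersurface ::
    "('e::euclidean_space \<Rightarrow> 'e \<Rightarrow> real) \<Rightarrow> 'e set \<Rightarrow> 'e set \<Rightarrow> bool" where
  "totally_geodesic_hypersurface g W S \<longleftrightarrow> hypersurface W S \<and> connected S \<and>
     (\<forall>V N. openin (top_of_set S) V \<and> unit_normal g W V N \<longrightarrow>
        (\<forall>p\<in>V. \<forall>X\<in>tangent_space S p. shape_operator g W V N p X = 0))"

definition gradient ::
    "('e::euclidean_space \<Rightarrow> 'e \<Rightarrow> real) \<Rightarrow> 'e set \<Rightarrow> ('e \<Rightarrow> real) \<Rightarrow> 'e \<Rightarrow> 'e" where
  "gradient g S f p =
     (THE v. v \<in> tangent_space S p \<and>
        (\<forall>X\<in>tangent_space S p. g v X = frechet_derivative f (at p within S) X))"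

definition riemannian_isometry ::
    "('e::euclidean_space \<Rightarrow> 'e \<Rightarrow> real) \<Rightarrow> 'e set \<Rightarrow> ('e \<Rightarrow> 'e) \<Rightarrow> bool" where
  "riemannian_isometry g W f \<longleftrightarrow>
     bij_betw f W W \<and> smooth_map_on W f \<and> smooth_map_on W (inv_into W f) \<and>
     (\<forall>p\<in>W. \<forall>X\<in>tangent_space W p. \<forall>Y\<in>tangent_space W p.
        g (frechet_derivative f (at p within W) X) (frechet_derivative f (at p within W) Y) = g X Y)"

definition one_parameter_isometry_group ::
    "('e::euclidean_space \<Rightarrow> 'e \<Rightarrow> real) \<Rightarrow> 'e set \<Rightarrow> (real \<Rightarrow> 'e \<Rightarrow> 'e) \<Rightarrow> bool" where
  "one_parameter_isometry_group g W \<Gamma> \<longleftrightarrow>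
     (\<forall>s. riemannian_isometry g W (\<Gamma> s)) \<and>
     (\<forall>p\<in>W. \<Gamma> 0 p = p) \<and>
     (\<forall>s t. \<forall>p\<in>W. \<Gamma> (s + t) p = \<Gamma> s (\<Gamma> t p)) \<and>
     smooth_map_on (UNIV \<times> W) (\<lambda>(s, p). \<Gamma> s p)"

section \<open>The space forms and their products with the real line\<close>

text \<open>One model for the three curvatures: the unit sphere for \<open>c = 1\<close>; the upper sheet of the
  hyperboloid in Lorentz-Minkowski space for \<open>c = -1\<close>; and for \<open>c = 0\<close> the affine hyperplane
  \<open>\<real>\<^sup>n \<times> {1}\<close>, with its Euclidean metric. The dimension is the cardinality of \<open>'n\<close>.\<close>

type_synonym 'n amb = "(real ^ 'n) \<times> real"

definition space_form :: "real \<Rightarrow> ('n::finite) amb set" where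
  "space_form c = {(x, u). c * (x \<bullet> x) + u\<^sup>2 = 1 \<and> (c \<le> 0 \<longrightarrow> u > 0)}"

definition space_metric :: "real \<Rightarrow> ('n::finite) amb \<Rightarrow> 'n amb \<Rightarrow> real" where
  "space_metric c X Y = fst X \<bullet> fst Y + c * snd X * snd Y"

definition space_line :: "real \<Rightarrow> ('n::finite amb \<times> real) set" where
  "space_line c = space_form c \<times> UNIV"

definition product_metric :: "real \<Rightarrow> ('n::finite amb \<times> real) \<Rightarrow> ('n amb \<times> real) \<Rightarrow> real" where
  "product_metric c X Y = space_metric c (fst X) (fst Y) + snd X * snd Y"

definition lorentz_metric :: "real \<Rightarrow> ('n::finite amb \<times> real) \<Rightarrow> ('n amb \<times> real) \<Rightarrow> real" where
  "lorentz_metric c X Y = space_metric c (fst X) (fst Y) - snd X * snd Y"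

definition d_t :: "'n::finite amb \<times> real" where
  "d_t = (0, 1)"

definition angle ::
    "real \<Rightarrow> ('n::finite amb \<times> real \<Rightarrow> 'n amb \<times> real) \<Rightarrow> 'n amb \<times> real \<Rightarrow> real" where
  "angle c N p = product_metric c (N p) d_t"

definition slice :: "real \<Rightarrow> real \<Rightarrow> ('n::finite amb \<times> real) set" where
  "slice c t = space_form c \<times> {t}"

definition transversal_slice :: "real \<Rightarrow> ('n::finite amb \<times> real) set \<Rightarrow> real \<Rightarrow> bool" where
  "transversal_slice c S t \<longleftrightarrow>
     (\<forall>p\<in>S \<inter> slice c t.
        {X + Y |X Y. X \<in> tangent_space S p \<and> Y \<in> tangent_space (slice c t) p}
          = tangent_space (space_line c) p)"

text \<open>Hypersurfaces carrying an angle function are taken connected, so that their unit normal is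
  unique up to a global sign and constancy of the angle does not depend on its choice.\<close>

definition vertical_helicoid :: "real \<Rightarrow> ('n::finite amb \<times> real) set \<Rightarrow> bool" where
  "vertical_helicoid c S \<longleftrightarrow>
     hypersurface (space_line c) S \<and> connected S \<and>
     (\<forall>t. transversal_slice c S t \<longrightarrow>
        minimal_hypersurface (product_metric c) (slice c t) (S \<inter> slice c t)) \<and>
     (\<exists>N. unit_normal (product_metric c) (space_line c) S N \<and>
        (\<forall>p\<in>S. (angle c N p)\<^sup>2 \<noteq> 1) \<and>
        \<not> angle c N constant_on S \<and>
        (\<forall>p\<in>S. let G = gradient (product_metric c) S snd p in
           product_metric c (shape_operator (product_metric c) (space_line c) S N p G) G = 0))"

definition twisting ::
    "(real \<Rightarrow> 'n::finite amb \<Rightarrow> 'n amb) \<Rightarrow> real \<Rightarrow> 'n amb set \<Rightarrow> ('n amb \<times> real) set" where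
  "twisting \<Gamma> a S\<^sub>0 = {(\<Gamma> s p, a * s) |s p. p \<in> S\<^sub>0}"

definition spacelike :: "real \<Rightarrow> ('n::finite amb \<times> real) set \<Rightarrow> bool" where
  "spacelike c S \<longleftrightarrow> (\<forall>p\<in>S. \<forall>X\<in>tangent_space S p. X \<noteq> 0 \<longrightarrow> lorentz_metric c X X > 0)"

definition lorentz_normal ::
    "real \<Rightarrow> ('n::finite amb \<times> real \<Rightarrow> 'n amb \<times> real) \<Rightarrow> 'n amb \<times> real \<Rightarrow> 'n amb \<times> real" where
  "lorentz_normal c N p =
     (- 1 / sqrt (2 * (angle c N p)\<^sup>2 - 1)) *\<^sub>R (N p - (2 * angle c N p) *\<^sub>R d_t)"

text \<open>The Riemannian and the Lorentzian product metrics have the same Levi-Civita connection.\<close>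

definition lorentz_shape_operator ::
    "real \<Rightarrow> ('n::finite amb \<times> real) set \<Rightarrow> ('n amb \<times> real \<Rightarrow> 'n amb \<times> real) \<Rightarrow>
     'n amb \<times> real \<Rightarrow> 'n amb \<times> real \<Rightarrow> 'n amb \<times> real" where
  "lorentz_shape_operator c S N p X =
     - levi_civita (product_metric c) (space_line c) S (lorentz_normal c N) p X"

definition lorentz_mean_curvature ::
    "real \<Rightarrow> ('n::finite amb \<times> real) set \<Rightarrow> ('n amb \<times> real \<Rightarrow> 'n amb \<times> real) \<Rightarrow>
     'n amb \<times> real \<Rightarrow> real" where
  "lorentz_mean_curvature c S N p =
     - trace_on (tangent_space S p) (lorentz_shape_operator c S N p)"

definition zero_mean_isocurved :: "real \<Rightarrow> ('n::finite amb \<times> real) set \<Rightarrow> bool" where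
  "zero_mean_isocurved c S \<longleftrightarrow>
     hypersurface (space_line c) S \<and> spacelike c S \<and>
     (\<exists>N. unit_normal (product_metric c) (space_line c) S N \<and>
        (\<forall>p\<in>S. mean_curvature (product_metric c) (space_line c) S N p = 0 \<and>
               lorentz_mean_curvature c S N p = 0))"

end

theory Submission imports Defs begin

text \<open>Fix orthonormal vectors \<open>e, f\<close> of \<open>\<real>\<^sup>n\<close>, put \<open>l = k / a\<close>, \<open>\<nu> = cos (l t) e + sin (l t) f\<close>,
  \<open>\<tau> = cos (l t) f - sin (l t) e\<close>, and let \<open>\<Sigma>\<close> consist of the points \<open>(x, u, t)\<close> of the product with
  \<open>x \<bullet> \<nu> = 0\<close>: the totally geodesic hypersurface \<open>x \<bullet> e = 0\<close> twisted by the rotations of the plane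
  of \<open>e\<close> and \<open>f\<close>. With \<open>q = x \<bullet> \<tau>\<close> the unit normal is a multiple of \<open>(\<nu>, 0, l q)\<close> and the second
  fundamental form is a multiple of the symmetric product of \<open>dt\<close> with \<open>X \<mapsto> X \<bullet> \<tau>\<close>. The gradient
  of \<open>t\<close> is a multiple of \<open>(- l q \<nu>, 0, 1)\<close>, on which the second factor vanishes; this gives both
  \<open>H = 0\<close> and \<open>\<langle>A \<nabla>\<xi>, \<nabla>\<xi>\<rangle> = 0\<close>. The Lorentzian normal is a multiple of \<open>(\<nu>, 0, - l q)\<close>, and the
  same computation gives \<open>H\<^sub>L = 0\<close> wherever \<open>\<Sigma>\<close> is spacelike, that is where \<open>l\<^sup>2 q\<^sup>2 > 1\<close>. As \<open>q\<close> takes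
  the value \<open>1\<close> for each \<open>c\<close>, the choice \<open>k = 2 a\<close> works.\<close>

subsection \<open>Calculus of smooth maps\<close>

text \<open>As \<open>U\<close> is open, values on \<open>U\<close> determine the full derivative
  \<open>at x\<close>, so the derivatives agree on \<open>U\<close> too and the induction continues
  with them.\<close>

lemma Ck_on_cong:
  assumes "open U" "\<And>x. x \<in> U \<Longrightarrow> f x = g x" "Ck_on k U f"
  shows "Ck_on k U g"
  using assms
proof (induction k arbitrary: f g)
  case 0
  then show ?case by (simp cong: continuous_on_cong)
next
  case (Suc k)
  have D: "(f has_derivative frechet_derivative f (at x)) (at x)" if "x \<in> U" for x
    using Suc.prems that by (simp add: differentiable_on_eq_differentiable_at frechet_derivative_works)
  have G: "(g has_derivative frechet_derivative f (at x)) (at x)" if "x \<in> U" for x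
    by (rule has_derivative_transform_within_open[OF D[OF that] Suc.prems(1) that Suc.prems(2)])
  have eq: "frechet_derivative f (at x) = frechet_derivative g (at x)" if "x \<in> U" for x
    using frechet_derivative_at[OF G[OF that]] .
  have "Ck_on k U (\<lambda>x. frechet_derivative g (at x) v)" for v
    by (rule Suc.IH[OF Suc.prems(1), where f = "\<lambda>x. frechet_derivative f (at x) v"])
      (use Suc.prems(3) in \<open>simp_all add: eq\<close>)
  moreover have "g differentiable_on U"
    using G Suc.prems(1) by (simp add: differentiable_on_eq_differentiable_at) (metis differentiable_def)
  ultimately show ?case by simp
qed

lemma Ck_on_subset: "Ck_on k U f \<Longrightarrow> V \<subseteq> U \<Longrightarrow> Ck_on k V f"
  by (induction k arbitrary: f) (auto intro: continuous_on_subset differentiable_on_subset)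

lemma Ck_on_Suc: "Ck_on (Suc k) U f \<Longrightarrow> Ck_on k U f"
  by (induction k arbitrary: f) (auto intro: differentiable_imp_continuous_on)

text \<open>By uniqueness of derivatives an explicit \<open>f'\<close> may stand in for
  \<open>frechet_derivative\<close>; the inductions below all pass through this rule.\<close>

lemma Ck_on_SucI:
  assumes "open U" "\<And>x. x \<in> U \<Longrightarrow> (f has_derivative f' x) (at x)"
    and "\<And>v. Ck_on k U (\<lambda>x. f' x v)"
  shows "Ck_on (Suc k) U f"
proof -
  have "f' x = frechet_derivative f (at x)" if "x \<in> U" for x
    using assms(2)[OF that] by (rule frechet_derivative_at)
  then have "Ck_on k U (\<lambda>x. frechet_derivative f (at x) v)" for v
    by (intro Ck_on_cong[OF assms(1) _ assms(3)]) auto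
  moreover have "f differentiable_on U"
    using assms(2) by (intro differentiable_at_imp_differentiable_on) (auto intro: differentiableI)
  ultimately show ?thesis by simp
qed

lemma Ck_on_has_derivative:
  assumes "open U" "Ck_on (Suc k) U f" "x \<in> U"
  shows "(f has_derivative frechet_derivative f (at x)) (at x)"
  using assms by (simp add: differentiable_on_eq_differentiable_at frechet_derivative_works)

lemma Ck_on_const: "Ck_on k U (\<lambda>x. a)"
  by (induction k arbitrary: a) (auto simp: frechet_derivative_const)

lemma Ck_on_bounded_linear:
  assumes "bounded_linear f" "open U"
  shows "Ck_on k U f"
proof (cases k)
  case 0
  then show ?thesis using assms by (simp add: linear_continuous_on)
next
  case (Suc m)
  show ?thesis unfolding Suc
    by (rule Ck_on_SucI[where f' = "\<lambda>x. f"])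
       (auto intro: bounded_linear_imp_has_derivative assms Ck_on_const)
qed

lemma Ck_on_add:
  assumes "open U" "Ck_on k U f" "Ck_on k U g"
  shows "Ck_on k U (\<lambda>x. f x + g x)"
  using assms(2,3)
proof (induction k arbitrary: f g)
  case 0
  then show ?case by (auto intro: continuous_intros)
next
  case (Suc k)
  show ?case
    by (rule Ck_on_SucI[OF assms(1) has_derivative_add[OF Ck_on_has_derivative Ck_on_has_derivative]])
       (use Suc assms in auto)
qed

text \<open>The product rule yields two products of the same kind, one factor differentiated once
  and the other merely lowered in order. Scaling, inner product and multiplication are
  instances.\<close>

lemma Ck_on_bounded_bilinear:
  assumes "bounded_bilinear B" "open U" "Ck_on k U f" "Ck_on k U g"
  shows "Ck_on k U (\<lambda>x. B (f x) (g x))"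
  using assms(3,4)
proof (induction k arbitrary: f g)
  case 0
  then show ?case by (auto intro: bounded_bilinear.continuous_on[OF assms(1)])
next
  case (Suc k)
  show ?case
  proof (rule Ck_on_SucI[OF assms(2)])
    show "((\<lambda>x. B (f x) (g x)) has_derivative
        (\<lambda>h. B (f x) (frechet_derivative g (at x) h) + B (frechet_derivative f (at x) h) (g x))) (at x)"
      if "x \<in> U" for x
      by (intro bounded_bilinear.FDERIV[OF assms(1)] Ck_on_has_derivative[OF assms(2)])
         (use Suc that in auto)
    show "Ck_on k U (\<lambda>x. B (f x) (frechet_derivative g (at x) v) + B (frechet_derivative f (at x) v) (g x))" for v
      using Suc by (auto intro!: Ck_on_add[OF assms(2)] Suc.IH intro: Ck_on_Suc)
  qed
qed

lemma Ck_on_linear_compose: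
  assumes "bounded_linear L" "open U" "Ck_on k U f"
  shows "Ck_on k U (\<lambda>x. L (f x))"
  using assms(3)
proof (induction k arbitrary: f)
  case 0
  then show ?case
    using continuous_on_compose2[OF linear_continuous_on[OF assms(1), of UNIV]] by auto
next
  case (Suc k)
  show ?case
    by (rule Ck_on_SucI[OF assms(2) bounded_linear.has_derivative[OF assms(1) Ck_on_has_derivative]])
       (use Suc assms in auto)
qed

text \<open>With a real variable in between, the chain rule is a single scalar multiple of
  \<open>?g' (f x)\<close>, so the induction, with \<open>g\<close> varying, closes by the bilinear
  rule.\<close>

lemma Ck_on_compose_real:
  fixes g :: "real \<Rightarrow> 'b::real_normed_vector"
  assumes "open U" "open V" "f ` U \<subseteq> V" "Ck_on k U f" "Ck_on k V g"
  shows "Ck_on k U (\<lambda>x. g (f x))"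
  using assms(4,5)
proof (induction k arbitrary: g)
  case 0
  then show ?case using assms by (auto intro: continuous_on_compose2)
next
  case (Suc k)
  let ?g' = "\<lambda>y. frechet_derivative g (at y) 1"
  have *: "(g has_derivative (\<lambda>h. h *\<^sub>R ?g' y)) (at y)" if "y \<in> V" for y
  proof -
    have D: "(g has_derivative frechet_derivative g (at y)) (at y)"
      using Ck_on_has_derivative[OF assms(2) Suc.prems(2) that] .
    have "frechet_derivative g (at y) h = h *\<^sub>R ?g' y" for h
      using linear_cmul[OF has_derivative_linear[OF D], of h 1] by simp
    then show ?thesis using D by (metis (no_types, lifting) ext)
  qed
  show ?case
  proof (rule Ck_on_SucI[OF assms(1)])
    show "((\<lambda>x. g (f x)) has_derivative (\<lambda>h. frechet_derivative f (at x) h *\<^sub>R ?g' (f x))) (at x)"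
      if "x \<in> U" for x
      using has_derivative_compose[OF Ck_on_has_derivative[OF assms(1) Suc.prems(1) that] *, of] assms(3) that
      by auto
    show "Ck_on k U (\<lambda>x. frechet_derivative f (at x) v *\<^sub>R ?g' (f x))" for v
      by (intro Ck_on_bounded_bilinear[OF bounded_bilinear_scaleR assms(1)] Suc.IH Ck_on_Suc[OF Suc.prems(1)])
         (use Suc.prems in auto)
  qed
qed

section \<open>Sine, cosine and real powers\<close>

text \<open>Simultaneous induction, since differentiation exchanges the two functions up to
  sign.\<close>

lemma Ck_on_sin_cos: "Ck_on k UNIV (sin :: real \<Rightarrow> real) \<and> Ck_on k UNIV (cos :: real \<Rightarrow> real)"
proof (induction k)
  case (Suc k)
  have "Ck_on k UNIV (\<lambda>x::real. v * cos x)" "Ck_on k UNIV (\<lambda>x::real. v * - sin x)" for v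
    using Ck_on_linear_compose[OF bounded_linear_mult_right[of v], of UNIV k cos]
      Ck_on_linear_compose[OF bounded_linear_mult_right[of "- v"], of UNIV k sin] Suc by auto
  moreover have "(sin has_derivative (\<lambda>v. v * cos x)) (at x)"
    "(cos has_derivative (\<lambda>v. v * - sin x)) (at x)" for x :: real
    by (auto intro!: derivative_eq_intros)
  ultimately show ?case
    by (intro conjI Ck_on_SucI) auto
qed (auto intro: continuous_intros)

text \<open>The exponent varies in the induction because differentiation lowers it by one. The
  exponent -1/2 serves later to normalise vectors.\<close>

lemma Ck_on_powr: "Ck_on k {0<..} (\<lambda>x::real. x powr a)"
proof (induction k arbitrary: a)
  case 0
  then show ?case by (auto intro: continuous_on_powr)
next
  case (Suc k)
  show ?case
  proof (rule Ck_on_SucI)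
    show "((\<lambda>x. x powr a) has_derivative (\<lambda>h. (a * h) * x powr (a - 1))) (at x)" if "x \<in> {0<..}" for x
      using that by (auto intro!: derivative_eq_intros simp: powr_diff field_simps)
    show "Ck_on k {0<..} (\<lambda>x. (a * v) * x powr (a - 1))" for v
      by (rule Ck_on_linear_compose[OF bounded_linear_mult_right _ Suc]) auto
  qed auto
qed

section \<open>Closure rules for smooth maps on open sets\<close>

named_theorems smooth_intros

lemma smooth_on_open_const [smooth_intros]: "open U \<Longrightarrow> smooth_on_open U (\<lambda>x. a)"
  by (simp add: smooth_on_open_def Ck_on_const)

lemma smooth_on_open_bounded_linear: "bounded_linear f \<Longrightarrow> open U \<Longrightarrow> smooth_on_open U f"
  by (simp add: smooth_on_open_def Ck_on_bounded_linear)

lemma smooth_on_open_ident [smooth_intros]: "open U \<Longrightarrow> smooth_on_open U (\<lambda>x. x)"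
  by (simp add: smooth_on_open_bounded_linear bounded_linear_ident)

lemma smooth_on_open_linear_compose:
  "bounded_linear L \<Longrightarrow> smooth_on_open U f \<Longrightarrow> smooth_on_open U (\<lambda>x. L (f x))"
  by (simp add: smooth_on_open_def Ck_on_linear_compose)

lemmas smooth_on_open_fst [smooth_intros] = smooth_on_open_linear_compose[OF bounded_linear_fst]
lemmas smooth_on_open_snd [smooth_intros] = smooth_on_open_linear_compose[OF bounded_linear_snd]

lemma smooth_on_open_add [smooth_intros]:
  "smooth_on_open U f \<Longrightarrow> smooth_on_open U g \<Longrightarrow> smooth_on_open U (\<lambda>x. f x + g x)"
  by (simp add: smooth_on_open_def Ck_on_add)

lemma smooth_on_open_uminus [smooth_intros]:
  "smooth_on_open U f \<Longrightarrow> smooth_on_open U (\<lambda>x. - f x)"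
  using smooth_on_open_linear_compose[OF bounded_linear_minus[OF bounded_linear_ident]] .

lemma smooth_on_open_diff [smooth_intros]:
  "smooth_on_open U f \<Longrightarrow> smooth_on_open U g \<Longrightarrow> smooth_on_open U (\<lambda>x. f x - g x)"
  using smooth_on_open_add[of U f "\<lambda>x. - g x"] by (simp add: smooth_on_open_uminus)

lemma smooth_on_open_bounded_bilinear:
  "bounded_bilinear B \<Longrightarrow> smooth_on_open U f \<Longrightarrow> smooth_on_open U g
    \<Longrightarrow> smooth_on_open U (\<lambda>x. B (f x) (g x))"
  by (simp add: smooth_on_open_def Ck_on_bounded_bilinear)

lemmas smooth_on_open_scaleR [smooth_intros] = smooth_on_open_bounded_bilinear[OF bounded_bilinear_scaleR]
lemmas smooth_on_open_inner [smooth_intros] = smooth_on_open_bounded_bilinear[OF bounded_bilinear_inner]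

lemma smooth_on_open_mult [smooth_intros]:
  "smooth_on_open U f \<Longrightarrow> smooth_on_open U g \<Longrightarrow> smooth_on_open U (\<lambda>x. f x * g x :: real)"
  by (rule smooth_on_open_bounded_bilinear[OF bounded_bilinear_mult])

lemma smooth_on_open_power [smooth_intros]:
  fixes f :: "'a::real_normed_vector \<Rightarrow> real"
  assumes f: "smooth_on_open U f"
  shows "smooth_on_open U (\<lambda>x. f x ^ m)"
proof (induction m)
  case 0
  have "open U" using f by (simp add: smooth_on_open_def)
  then show ?case by (simp add: smooth_on_open_const)
next
  case (Suc m)
  then show ?case using smooth_on_open_mult[OF f Suc] by simp
qed

lemma smooth_on_open_Pair [smooth_intros]:
  assumes "smooth_on_open U f" "smooth_on_open U g"
  shows "smooth_on_open U (\<lambda>x. (f x, g x))"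
proof -
  have "smooth_on_open U (\<lambda>x. (f x, 0) + (0, g x))"
    by (intro smooth_on_open_add smooth_on_open_linear_compose[OF _ assms(1)]
      smooth_on_open_linear_compose[OF _ assms(2)] bounded_linear_Pair bounded_linear_ident bounded_linear_zero)
  then show ?thesis by simp
qed

lemma smooth_on_open_sin [smooth_intros]:
  "smooth_on_open U f \<Longrightarrow> smooth_on_open U (\<lambda>x. sin (f x :: real))"
  unfolding smooth_on_open_def using Ck_on_compose_real[of U UNIV f] Ck_on_sin_cos by auto

lemma smooth_on_open_cos [smooth_intros]:
  "smooth_on_open U f \<Longrightarrow> smooth_on_open U (\<lambda>x. cos (f x :: real))"
  unfolding smooth_on_open_def using Ck_on_compose_real[of U UNIV f] Ck_on_sin_cos by auto

lemma smooth_on_open_powr [smooth_intros]: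
  fixes f :: "'a::real_normed_vector \<Rightarrow> real"
  assumes "smooth_on_open U f" "\<And>x. x \<in> U \<Longrightarrow> 0 < f x"
  shows "smooth_on_open U (\<lambda>x. f x powr a)"
proof -
  have "f ` U \<subseteq> {0<..}" using assms(2) by auto
  then show ?thesis
    using assms(1) Ck_on_compose_real[of U "{0<..}" f _ "\<lambda>x. x powr a"] Ck_on_powr unfolding smooth_on_open_def by simp
qed

lemma smooth_on_open_subset:
  "smooth_on_open U f \<Longrightarrow> open V \<Longrightarrow> V \<subseteq> U \<Longrightarrow> smooth_on_open V f"
  unfolding smooth_on_open_def using Ck_on_subset by blast

lemma smooth_on_open_has_derivative:
  "smooth_on_open U f \<Longrightarrow> x \<in> U \<Longrightarrow> (f has_derivative frechet_derivative f (at x)) (at x)"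
  unfolding smooth_on_open_def using Ck_on_has_derivative by blast

lemma smooth_on_open_continuous_on: "smooth_on_open U f \<Longrightarrow> continuous_on U f"
  unfolding smooth_on_open_def by (metis Ck_on.simps(1))

section \<open>Smooth maps on arbitrary subsets\<close>

lemma smooth_map_onI: "smooth_on_open U f \<Longrightarrow> S \<subseteq> U \<Longrightarrow> (\<And>x. x \<in> S \<Longrightarrow> f x = g x) \<Longrightarrow> smooth_map_on S g"
  unfolding smooth_map_on_def by (metis Int_iff subset_iff)

lemma smooth_map_on_differentiable:
  assumes "smooth_map_on S f" "p \<in> S"
  shows "f differentiable (at p within S)"
proof -
  from assms obtain U F where U: "p \<in> U" "smooth_on_open U F" "\<forall>x\<in>S \<inter> U. F x = f x"
    unfolding smooth_map_on_def by blast
  then obtain d where d: "d > 0" "ball p d \<subseteq> U"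
    using open_contains_ball unfolding smooth_on_open_def by blast
  have "(F has_derivative frechet_derivative F (at p)) (at p within S)"
    by (rule has_derivative_at_withinI[OF smooth_on_open_has_derivative[OF U(2,1)]])
  then have "(f has_derivative frechet_derivative F (at p)) (at p within S)"
    by (rule has_derivative_transform_within[OF _ d(1) assms(2)])
       (use U d in \<open>auto simp: dist_commute subset_iff\<close>)
  then show ?thesis unfolding differentiable_def by blast
qed

lemma smooth_map_on_continuous: "smooth_map_on S f \<Longrightarrow> continuous_on S f"
  using smooth_map_on_differentiable
  by (intro differentiable_imp_continuous_on) (auto simp: differentiable_on_def)

subsection \<open>Tangent spaces\<close>

text \<open>Curves constructed later come with an open domain that is no symmetric interval; the
  smaller of two radii brings them into the form of the definition.\<close>

lemma tangent_spaceI: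
  assumes U: "smooth_on_open U \<gamma>" "0 \<in> U" and ev: "\<forall>\<^sub>F s in nhds 0. \<gamma> s \<in> S"
    and \<gamma>: "\<gamma> 0 = p" "(\<gamma> has_vector_derivative v) (at 0)"
  shows "v \<in> tangent_space S p"
proof -
  obtain d1 where d1: "d1 > 0" "\<And>s. dist s 0 < d1 \<Longrightarrow> \<gamma> s \<in> S"
    using ev unfolding eventually_nhds_metric by blast
  have "open U" using U by (simp add: smooth_on_open_def)
  then obtain d2 where d2: "d2 > 0" "ball 0 d2 \<subseteq> U"
    using U(2) open_contains_ball by blast
  define \<epsilon> where "\<epsilon> = min d1 d2"
  have "\<epsilon> > 0" using d1 d2 by (simp add: \<epsilon>_def)
  moreover have sub: "{-\<epsilon><..<\<epsilon>} \<subseteq> U"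
    using d2(2) by (auto simp: \<epsilon>_def dist_real_def subset_iff)
  then have "smooth_on_open {-\<epsilon><..<\<epsilon>} \<gamma>"
    by (intro smooth_on_open_subset[OF U(1)]) auto
  moreover have "\<gamma> ` {-\<epsilon><..<\<epsilon>} \<subseteq> S"
    using d1(2) by (auto simp: \<epsilon>_def dist_real_def)
  ultimately show ?thesis unfolding tangent_space_def using \<gamma> by blast
qed

lemma tangent_spaceE:
  assumes "v \<in> tangent_space S p"
  obtains \<gamma> \<epsilon> where "0 < \<epsilon>" "smooth_on_open {-\<epsilon><..<\<epsilon>} \<gamma>" "\<And>s. s \<in> {-\<epsilon><..<\<epsilon>} \<Longrightarrow> \<gamma> s \<in> S"
    "\<gamma> 0 = p" "(\<gamma> has_vector_derivative v) (at 0)"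
  using assms unfolding tangent_space_def by blast

lemma tangent_space_mono: "S \<subseteq> T \<Longrightarrow> tangent_space S p \<subseteq> tangent_space T p"
  unfolding tangent_space_def by blast

text \<open>By continuity a curve in \<open>S\<close> through a point of the open piece stays in the
  piece for small parameters.\<close>

lemma tangent_space_openin:
  assumes "openin (top_of_set S) V" "p \<in> V"
  shows "tangent_space V p = tangent_space S p"
proof
  obtain O' where O': "open O'" "V = S \<inter> O'"
    using assms(1) by (auto simp: openin_open)
  show "tangent_space V p \<subseteq> tangent_space S p"
    using O' by (intro tangent_space_mono) auto
  show "tangent_space S p \<subseteq> tangent_space V p"
  proof
    fix v assume "v \<in> tangent_space S p"
    then obtain \<gamma> \<epsilon> where \<gamma>: "0 < \<epsilon>" "smooth_on_open {-\<epsilon><..<\<epsilon>} \<gamma>" "\<And>s. s \<in> {-\<epsilon><..<\<epsilon>} \<Longrightarrow> \<gamma> s \<in> S"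
      "\<gamma> 0 = p" "(\<gamma> has_vector_derivative v) (at 0)"
      by (rule tangent_spaceE) blast
    have "isCont \<gamma> 0"
      using \<gamma>(5) has_vector_derivative_continuous by blast
    then have "\<forall>\<^sub>F s in nhds 0. \<gamma> s \<in> O'"
      using O' assms(2) \<gamma>(4) unfolding continuous_at_open eventually_nhds by blast
    moreover have "\<forall>\<^sub>F s in nhds 0. s \<in> {-\<epsilon><..<\<epsilon>}"
      using \<gamma>(1) by (intro eventually_nhds_in_open) auto
    ultimately have "\<forall>\<^sub>F s in nhds 0. \<gamma> s \<in> V"
      by eventually_elim (use \<gamma>(3) O' in auto)
    then show "v \<in> tangent_space V p"
      using \<gamma> by (intro tangent_spaceI[OF \<gamma>(2)]) auto
  qed
qed

section \<open>Derivatives in tangent directions\<close>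

text \<open>Differentiability is known only within \<open>S\<close>, but the curve does not leave
  \<open>S\<close>, so the chain rule within its image applies.\<close>

lemma has_vector_derivative_along_curve:
  assumes f: "(f has_derivative D) (at p within S)" and "0 < \<epsilon>"
    and \<gamma>: "\<And>s. s \<in> {-\<epsilon><..<\<epsilon>} \<Longrightarrow> \<gamma> s \<in> S" "\<gamma> 0 = p" "(\<gamma> has_vector_derivative v) (at 0)"
  shows "((\<lambda>s. f (\<gamma> s)) has_vector_derivative D v) (at (0::real))"
proof -
  let ?I = "{-\<epsilon><..<\<epsilon>}"
  have at: "at 0 within ?I = at 0"
    using \<open>0 < \<epsilon>\<close> by (intro at_within_open) auto
  have "(\<gamma> has_derivative (\<lambda>h. h *\<^sub>R v)) (at 0 within ?I)"
    using \<gamma>(3) by (simp add: at has_vector_derivative_def)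
  moreover have "(f has_derivative D) (at (\<gamma> 0) within \<gamma> ` ?I)"
    unfolding \<gamma>(2) using \<gamma>(1) by (intro has_derivative_subset[OF f]) auto
  ultimately have "((\<lambda>s. f (\<gamma> s)) has_derivative (\<lambda>h. D (h *\<^sub>R v))) (at 0 within ?I)"
    by (rule has_derivative_in_compose)
  then show ?thesis
    using linear_cmul[OF has_derivative_linear[OF f]] by (simp add: at has_vector_derivative_def)
qed

text \<open>Derivatives within \<open>S\<close> need not be unique, yet on a tangent vector each of
  them is the velocity of \<open>f\<close> along the same curve. This evaluates the derivatives
  inside the connection and the gradient.\<close>

lemma frechet_derivative_within_tangent:
  assumes "(f has_derivative D) (at p within S)" "v \<in> tangent_space S p"
  shows "frechet_derivative f (at p within S) v = D v"
proof -
  have f: "(f has_derivative frechet_derivative f (at p within S)) (at p within S)"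
    using assms(1) frechet_derivative_works differentiableI by blast
  obtain \<gamma> \<epsilon> where \<gamma>: "0 < \<epsilon>" "\<And>s. s \<in> {-\<epsilon><..<\<epsilon>} \<Longrightarrow> \<gamma> s \<in> S"
      "\<gamma> 0 = p" "(\<gamma> has_vector_derivative v) (at (0::real))"
    using assms(2) by (rule tangent_spaceE) blast
  show ?thesis
    using has_vector_derivative_along_curve[OF f \<gamma>] has_vector_derivative_along_curve[OF assms(1) \<gamma>]
    by (rule vector_derivative_unique_at)
qed

text \<open>\<open>F\<close> is constant along curves in \<open>S\<close>. This bounds tangent
  spaces by kernels; the converse inclusions need explicit curves.\<close>

lemma tangent_space_level_set:
  assumes "(F has_derivative D) (at p)" "\<And>x. x \<in> S \<Longrightarrow> F x = a" "v \<in> tangent_space S p"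
  shows "D v = 0"
proof -
  obtain \<gamma> \<epsilon> where \<gamma>: "0 < \<epsilon>" "\<And>s. s \<in> {-\<epsilon><..<\<epsilon>} \<Longrightarrow> \<gamma> s \<in> S"
      "\<gamma> 0 = p" "(\<gamma> has_vector_derivative v) (at (0::real))"
    using assms(3) by (rule tangent_spaceE) blast
  have "((\<lambda>s. F (\<gamma> s)) has_vector_derivative D v) (at 0)"
    by (rule has_vector_derivative_along_curve[OF has_derivative_at_withinI[OF assms(1)] \<gamma>])
  moreover have "((\<lambda>s. F (\<gamma> s)) has_vector_derivative 0) (at 0)"
    by (rule has_vector_derivative_transform_within_open[where S = "{-\<epsilon><..<\<epsilon>}" and f = "\<lambda>s. a"])
       (use \<gamma> assms(2) in auto)
  ultimately show ?thesis by (rule vector_derivative_unique_at)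
qed

lemma tangent_space_linear_image:
  assumes "bounded_linear L" "L ` S \<subseteq> T" "v \<in> tangent_space S p"
  shows "L v \<in> tangent_space T (L p)"
proof -
  obtain \<gamma> \<epsilon> where \<gamma>: "0 < \<epsilon>" "smooth_on_open {-\<epsilon><..<\<epsilon>} \<gamma>" "\<And>s. s \<in> {-\<epsilon><..<\<epsilon>} \<Longrightarrow> \<gamma> s \<in> S"
      "\<gamma> 0 = p" "(\<gamma> has_vector_derivative v) (at (0::real))"
    using assms(3) by (rule tangent_spaceE) blast
  have "(\<lambda>s. L (\<gamma> s)) ` {-\<epsilon><..<\<epsilon>} \<subseteq> T"
    using \<gamma>(3) assms(2) by blast
  then show ?thesis
    unfolding tangent_space_def
    using \<gamma> smooth_on_open_linear_compose[OF assms(1) \<gamma>(2)] bounded_linear.has_vector_derivative[OF assms(1) \<gamma>(5)]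
    by (auto intro!: exI[of _ "\<lambda>s. L (\<gamma> s)"] exI[of _ \<epsilon>])
qed

text \<open>The affine second component covers both products at once: \<open>I\<close> the whole
  line with any \<open>r\<close>, and \<open>I\<close> the single point \<open>t\<close> with
  \<open>r = 0\<close>.\<close>

lemma tangent_space_Times_line:
  assumes "v \<in> tangent_space S p" "\<And>s::real. t + s * r \<in> I"
  shows "(v, r) \<in> tangent_space (S \<times> I) (p, t)"
proof -
  obtain \<gamma> \<epsilon> where \<gamma>: "0 < \<epsilon>" "smooth_on_open {-\<epsilon><..<\<epsilon>} \<gamma>" "\<And>s. s \<in> {-\<epsilon><..<\<epsilon>} \<Longrightarrow> \<gamma> s \<in> S"
      "\<gamma> 0 = p" "(\<gamma> has_vector_derivative v) (at (0::real))"
    using assms(1) by (rule tangent_spaceE) blast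
  let ?c = "\<lambda>s. (\<gamma> s, t + s * r)"
  have "smooth_on_open {-\<epsilon><..<\<epsilon>} ?c"
    by (intro smooth_intros \<gamma>) auto
  moreover have "((\<lambda>s. t + s * r) has_vector_derivative r) (at 0)"
    by (auto intro!: derivative_eq_intros simp: has_real_derivative_iff_has_vector_derivative[symmetric])
  then have "(?c has_vector_derivative (v, r)) (at 0)"
    by (rule has_vector_derivative_Pair[OF \<gamma>(5)])
  moreover have "?c ` {-\<epsilon><..<\<epsilon>} \<subseteq> S \<times> I" using \<gamma>(3) assms(2) by auto
  ultimately show ?thesis
    unfolding tangent_space_def using \<gamma>(1,4) by (auto intro!: exI[of _ ?c] exI[of _ \<epsilon>])
qed

lemma tangent_space_Times_UNIV:
  "tangent_space (S \<times> (UNIV :: real set)) (p, t) = tangent_space S p \<times> UNIV"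
  using tangent_space_linear_image[OF bounded_linear_fst, of "S \<times> UNIV" S _ "(p, t)"]
  by (force intro: tangent_space_Times_line)

lemma tangent_space_Times_singleton:
  "tangent_space (S \<times> {t :: real}) (p, t) = tangent_space S p \<times> {0}"
proof -
  have "snd v = 0" if "v \<in> tangent_space (S \<times> {t}) (p, t)" for v
    by (rule tangent_space_level_set[OF _ _ that, of snd snd t])
       (auto intro: bounded_linear_imp_has_derivative bounded_linear_snd)
  moreover have "fst v \<in> tangent_space S p" if "v \<in> tangent_space (S \<times> {t}) (p, t)" for v
    using tangent_space_linear_image[OF bounded_linear_fst _ that, of S] by auto
  moreover have "(v, 0) \<in> tangent_space (S \<times> {t}) (p, t)" if "v \<in> tangent_space S p" for v
    using that by (rule tangent_space_Times_line) simp
  ultimately show ?thesis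
    by (auto simp: mem_Times_iff)
qed

subsection \<open>Submanifolds with a constant bilinear form\<close>

text \<open>Positivity is asked on \<open>T\<close> only, since on the ambient space
  \<open>space_metric\<close> is degenerate for c = 0 and indefinite for c = -1.\<close>

definition pos_def_on :: "('e::euclidean_space \<Rightarrow> 'e \<Rightarrow> real) \<Rightarrow> 'e set \<Rightarrow> bool" where
  "pos_def_on g T \<longleftrightarrow> bilinear g \<and> (\<forall>X Y. g X Y = g Y X) \<and> subspace T \<and> (\<forall>X\<in>T. X \<noteq> 0 \<longrightarrow> 0 < g X X)"

lemma pos_def_on_subset: "pos_def_on g T \<Longrightarrow> subspace S \<Longrightarrow> S \<subseteq> T \<Longrightarrow> pos_def_on g S"
  unfolding pos_def_on_def by blast

text \<open>The difference of two candidates is tangent and orthogonal to itself, hence zero. So the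
  connection is computed by exhibiting an orthogonal projection.\<close>

lemma levi_civita_eq:
  assumes g: "pos_def_on g (tangent_space W p)"
    and y: "frechet_derivative Y (at p within S) X = y"
    and w: "w \<in> tangent_space W p" "\<And>Z. Z \<in> tangent_space W p \<Longrightarrow> g (y - w) Z = 0"
  shows "levi_civita g W S Y p X = w"
  unfolding levi_civita_def y
proof (rule the_equality)
  fix w' assume w': "w' \<in> tangent_space W p \<and> (\<forall>Z\<in>tangent_space W p. g (y - w') Z = 0)"
  have d: "w' - w \<in> tangent_space W p"
    using g w w' by (simp add: pos_def_on_def subspace_diff)
  have "g (w' - w) (w' - w) = g (y - w) (w' - w) - g (y - w') (w' - w)"
    using g bilinear_lsub[of g "y - w" "y - w'"] by (simp add: pos_def_on_def)
  also have "\<dots> = 0" using w w' d by simp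
  finally show "w' = w" using g d by (auto simp: pos_def_on_def)
qed (use w in auto)

text \<open>Uniqueness is again positive definiteness applied to the difference of two
  candidates.\<close>

lemma gradient_eq:
  assumes g: "pos_def_on g (tangent_space S p)"
    and f: "(f has_derivative D) (at p within S)"
    and v: "v \<in> tangent_space S p" "\<And>X. X \<in> tangent_space S p \<Longrightarrow> g v X = D X"
  shows "gradient g S f p = v"
  unfolding gradient_def
proof (rule the_equality)
  show "v \<in> tangent_space S p \<and> (\<forall>X\<in>tangent_space S p. g v X = frechet_derivative f (at p within S) X)"
    using v by (simp add: frechet_derivative_within_tangent[OF f])
  fix v' assume v': "v' \<in> tangent_space S p \<and> (\<forall>X\<in>tangent_space S p. g v' X = frechet_derivative f (at p within S) X)"
  have d: "v' - v \<in> tangent_space S p"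
    using g v v' by (simp add: pos_def_on_def subspace_diff)
  have "g (v' - v) (v' - v) = g v' (v' - v) - g v (v' - v)"
    using g by (simp add: pos_def_on_def bilinear_lsub)
  also have "\<dots> = 0" using v v' d by (simp add: frechet_derivative_within_tangent[OF f])
  finally show "v' = v" using g d by (auto simp: pos_def_on_def)
qed

text \<open>In any basis the coefficients of \<open>G\<close>, weighted by the values of
  \<open>\<alpha>\<close> on the basis, sum to \<open>\<alpha> G\<close>, and likewise for
  \<open>H\<close>; the basis picked in \<open>trace_on\<close> does not matter.\<close>

lemma trace_on_rank_two:
  assumes "subspace V" "linear \<alpha>" "linear \<beta>" "G \<in> V" "H \<in> V"
    and A: "\<And>X. X \<in> V \<Longrightarrow> A X = \<alpha> X *\<^sub>R G + \<beta> X *\<^sub>R H"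
  shows "trace_on V A = \<alpha> G + \<beta> H"
proof -
  define b where "b = (SOME b. independent b \<and> span b = V)"
  have "\<exists>b. independent b \<and> span b = V"
    using basis_exists[of V] span_subspace[OF _ _ assms(1)] by metis
  then have b: "independent b" "span b = V"
    unfolding b_def by (metis (mono_tags, lifting) someI_ex)+
  then have fin: "finite b" by (simp add: independent_imp_finite)
  have rep: "representation b (A e) e = \<alpha> e * representation b G e + \<beta> e * representation b H e" if "e \<in> b" for e
  proof -
    have "e \<in> V" using that b span_base by blast
    then show ?thesis
      using b assms by (simp add: representation_add representation_scale subspace_scale)
  qed
  have lin: "(\<Sum>e\<in>b. \<phi> e * representation b Z e) = \<phi> Z" if "linear \<phi>" "Z \<in> V" for \<phi> :: "'a \<Rightarrow> real" and Z
  proof -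
    have "\<phi> Z = \<phi> (\<Sum>e\<in>b. representation b Z e *\<^sub>R e)"
      using b fin that by (subst sum_representation_eq) auto
    then show ?thesis
      using that by (simp add: linear_sum linear_cmul mult.commute)
  qed
  have "trace_on V A = (\<Sum>e\<in>b. representation b (A e) e)"
    by (simp add: trace_on_def b_def Let_def)
  also have "\<dots> = \<alpha> G + \<beta> H"
    using lin[OF assms(2,4)] lin[OF assms(3,5)] by (simp add: rep sum.distrib)
  finally show ?thesis .
qed

lemma trace_on_eq_0:
  assumes "subspace V" "\<And>X. X \<in> V \<Longrightarrow> A X = 0"
  shows "trace_on V A = 0"
  using trace_on_rank_two[of V "\<lambda>_. 0" "\<lambda>_. 0" 0 0 A] assms by (simp add: subspace_0 linear_zero)

text \<open>A unit normal of an open piece takes the values \<open>\<nu>\<close> and \<open>-\<nu>\<close> only, so it is constant along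
  curves.\<close>

lemma shape_operator_constant_normal:
  assumes g: "\<And>q. q \<in> S \<Longrightarrow> pos_def_on g (tangent_space W q)"
    and \<nu>: "\<And>q. q \<in> S \<Longrightarrow> \<nu> \<in> tangent_space W q" "g \<nu> \<nu> = 1"
    and TS: "\<And>q. q \<in> S \<Longrightarrow> tangent_space S q = {X \<in> tangent_space W q. g X \<nu> = 0}"
    and V: "openin (top_of_set S) V" and N: "unit_normal g W V N"
    and p: "p \<in> V" and X: "X \<in> tangent_space S p"
  shows "shape_operator g W V N p X = 0"
proof -
  have VS: "V \<subseteq> S" using V openin_imp_subset by blast
  have Nv: "N q = \<nu> \<or> N q = - \<nu>" if q: "q \<in> V" for q
  proof -
    have qS: "q \<in> S" using q VS by blast
    note gq = g[OF qS, unfolded pos_def_on_def]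
    have bl: "bilinear g" using gq by blast
    have Nq: "N q \<in> tangent_space W q" "g (N q) (N q) = 1" "\<And>X. X \<in> tangent_space S q \<Longrightarrow> g (N q) X = 0"
      using N q tangent_space_openin[OF V q] by (auto simp: unit_normal_def)
    \<comment> \<open>\<open>Y\<close> is the part of \<open>N q\<close> orthogonal to
      \<open>\<nu>\<close>, hence tangent to \<open>S\<close>. Being orthogonal to both
      \<open>N q\<close> and \<open>\<nu>\<close>, it is orthogonal to itself.\<close>
    define a where "a = g (N q) \<nu>"
    define Y where "Y = N q - a *\<^sub>R \<nu>"
    have Y: "Y \<in> tangent_space W q"
      using gq Nq \<nu>(1)[OF qS] by (simp add: Y_def subspace_diff subspace_scale)
    have gY: "g Y \<nu> = 0"
      using \<nu>(2) by (simp add: Y_def bilinear_lsub[OF bl] bilinear_lmul[OF bl] a_def)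
    then have "g (N q) Y = 0" using Nq(3) TS[OF qS] Y by simp
    moreover have "g Y Y = g (N q) Y - a * g \<nu> Y"
      by (subst (1) Y_def) (simp add: bilinear_lsub[OF bl] bilinear_lmul[OF bl])
    moreover have "g \<nu> Y = 0" using gY gq by metis
    ultimately have "g Y Y = 0" by simp
    then have "Y = 0" using gq Y by force
    then have Na: "N q = a *\<^sub>R \<nu>" by (simp add: Y_def)
    then have "a * a = 1" using Nq(2) \<nu>(2) by (simp add: bilinear_lmul[OF bl] bilinear_rmul[OF bl])
    then have "a = 1 \<or> a = -1" by (simp add: square_eq_1_iff)
    then show ?thesis using Na by auto
  qed
  have NS: "smooth_map_on V N" using N by (simp add: unit_normal_def)
  let ?D = "frechet_derivative N (at p within V)"
  have D: "(N has_derivative ?D) (at p within V)"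
    using smooth_map_on_differentiable[OF NS p] frechet_derivative_works by blast
  have XV: "X \<in> tangent_space V p" using X tangent_space_openin[OF V p] by simp
  then obtain \<gamma> \<epsilon> where \<gamma>: "0 < \<epsilon>" "smooth_on_open {-\<epsilon><..<\<epsilon>} \<gamma>" "\<And>s. s \<in> {-\<epsilon><..<\<epsilon>} \<Longrightarrow> \<gamma> s \<in> V"
      "\<gamma> 0 = p" "(\<gamma> has_vector_derivative X) (at (0::real))"
    by (rule tangent_spaceE) blast
  let ?I = "{-\<epsilon><..<\<epsilon>}"
  have cont: "continuous_on ?I (\<lambda>s. N (\<gamma> s))"
    by (rule continuous_on_compose2[OF smooth_map_on_continuous[OF NS] smooth_on_open_continuous_on[OF \<gamma>(2)]])
      (use \<gamma>(3) in blast)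
  have dN: "((\<lambda>s. N (\<gamma> s)) has_vector_derivative ?D X) (at 0)"
    by (rule has_vector_derivative_along_curve[OF D \<gamma>(1) \<gamma>(3-5)])
  have "?D X \<bullet> i = 0" for i
  proof -
    have "(\<lambda>s. N (\<gamma> s) \<bullet> i) constant_on ?I"
    proof (rule continuous_finite_range_constant)
      show "continuous_on ?I (\<lambda>s. N (\<gamma> s) \<bullet> i)"
        by (intro continuous_on_inner cont continuous_on_const)
      have "(\<lambda>s. N (\<gamma> s) \<bullet> i) ` ?I \<subseteq> {\<nu> \<bullet> i, - \<nu> \<bullet> i}"
        using Nv \<gamma>(3) by fastforce
      then show "finite ((\<lambda>s. N (\<gamma> s) \<bullet> i) ` ?I)"
        using finite_subset by blast
    qed auto
    then obtain a where a: "\<And>s. s \<in> ?I \<Longrightarrow> N (\<gamma> s) \<bullet> i = a"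
      unfolding constant_on_def by blast
    have "((\<lambda>s. N (\<gamma> s) \<bullet> i) has_vector_derivative 0) (at 0)"
      by (rule has_vector_derivative_transform_within_open[where S = ?I and f = "\<lambda>s. a"])
         (use \<gamma>(1) a in auto)
    moreover have "((\<lambda>s. N (\<gamma> s) \<bullet> i) has_vector_derivative ?D X \<bullet> i) (at 0)"
      using bounded_linear.has_vector_derivative[OF bounded_linear_inner_left dN] .
    ultimately show ?thesis using vector_derivative_unique_at by blast
  qed
  then have D0: "?D X = 0" by (metis inner_eq_zero_iff)
  have pd: "pos_def_on g (tangent_space W p)" using g p VS by blast
  then have "levi_civita g W V N p X = 0"
    by (rule levi_civita_eq[OF _ D0]) (use pd in \<open>simp_all add: pos_def_on_def subspace_0 bilinear_lzero bilinear_rzero\<close>)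
  then show ?thesis by (simp add: shape_operator_def)
qed

lemma hypersurface_level_setI:
  fixes F :: "'e::euclidean_space \<Rightarrow> real"
  assumes "smooth_on_open U F" "S = {x \<in> W \<inter> U. F x = 0}"
    and "\<And>x. x \<in> S \<Longrightarrow> \<exists>D. (F has_derivative D) (at x) \<and> (\<exists>X\<in>tangent_space W x. D X \<noteq> 0)"
  shows "hypersurface W S"
proof -
  have "\<exists>X\<in>tangent_space W x. frechet_derivative F (at x) X \<noteq> 0" if x: "x \<in> S" for x
  proof -
    obtain D X where D: "(F has_derivative D) (at x)" "X \<in> tangent_space W x" "D X \<noteq> 0"
      using assms(3)[OF x] by blast
    then show ?thesis using frechet_derivative_at[OF D(1)] by auto
  qed
  then show ?thesis
    unfolding hypersurface_def using assms(1,2)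
    by (intro conjI ballI exI[of _ U] exI[of _ F]) auto
qed

subsection \<open>Space forms and their totally geodesic hypersurfaces\<close>

lemma space_form_iff: "(x, u) \<in> space_form c \<longleftrightarrow> c * (x \<bullet> x) + u\<^sup>2 = 1 \<and> (c \<le> 0 \<longrightarrow> u > 0)"
  by (simp add: space_form_def)

text \<open>The curve is the normalisation of the affine line through \<open>p\<close> in the direction \<open>X\<close>; it does
  not leave the plane spanned by \<open>p\<close> and \<open>X\<close>.\<close>

lemma space_form_curve:
  fixes x v :: "real ^ 'n::finite"
  assumes p: "(x, u) \<in> space_form c" and X: "c * (x \<bullet> v) + u * z = 0"
  obtains U \<sigma> where "smooth_on_open U \<sigma>" "0 \<in> U" "\<And>s. s \<in> U \<Longrightarrow> \<sigma> s \<in> space_form c"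
    "\<And>s. s \<in> U \<Longrightarrow> \<exists>a. \<sigma> s = a *\<^sub>R ((x, u) + s *\<^sub>R (v, z))" "\<sigma> 0 = (x, u)"
    "(\<sigma> has_vector_derivative (v, z)) (at 0)"
proof -
  \<comment> \<open>The quadratic form defining the model is 1 at the point and has no mixed term
    with the direction, so at parameter \<open>s\<close> of the line it equals
    \<open>1 + s\<^sup>2 * C\<close>; \<open>\<rho>\<close> is the inverse of its square
    root.\<close>
  define C where "C = c * (v \<bullet> v) + z\<^sup>2"
  define \<rho> where "\<rho> s = (1 + s\<^sup>2 * C) powr (-1/2)" for s :: real
  define \<sigma> where "\<sigma> s = \<rho> s *\<^sub>R ((x, u) + s *\<^sub>R (v, z))" for s
  \<comment> \<open>Here the root is defined and, on the models with a sign condition, the last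
    coordinate remains positive.\<close>
  define U where "U = {s. 0 < 1 + s\<^sup>2 * C} \<inter> (if c \<le> 0 then {s. 0 < u + s * z} else UNIV)"
  have "open U"
    unfolding U_def by (auto intro!: open_Int open_Collect_less continuous_intros)
  moreover have "0 \<in> U" using p by (simp add: U_def space_form_iff)
  moreover have sm: "smooth_on_open U \<sigma>"
    unfolding \<sigma>_def \<rho>_def
    by (intro smooth_intros \<open>open U\<close>) (auto simp: U_def)
  moreover have "\<sigma> s \<in> space_form c" if s: "s \<in> U" for s
  proof -
    have pos: "0 < 1 + s\<^sup>2 * C" using s by (simp add: U_def)
    have "\<rho> s * \<rho> s = (1 + s\<^sup>2 * C) powr -1"
      unfolding \<rho>_def powr_add[symmetric] by simp
    then have \<rho>: "\<rho> s > 0" "\<rho> s * \<rho> s * (1 + s\<^sup>2 * C) = 1"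
      using pos by (simp_all add: \<rho>_def powr_minus)
    have "c * ((x + s *\<^sub>R v) \<bullet> (x + s *\<^sub>R v)) + (u + s * z)\<^sup>2
        = (c * (x \<bullet> x) + u\<^sup>2) + 2 * s * (c * (x \<bullet> v) + u * z) + s\<^sup>2 * C"
      by (simp add: C_def inner_add_left inner_add_right inner_commute power2_eq_square algebra_simps)
    also have "\<dots> = 1 + s\<^sup>2 * C" using p X by (simp add: space_form_iff)
    finally have *: "c * ((x + s *\<^sub>R v) \<bullet> (x + s *\<^sub>R v)) + (u + s * z)\<^sup>2 = 1 + s\<^sup>2 * C" .
    have "c * ((\<rho> s *\<^sub>R (x + s *\<^sub>R v)) \<bullet> (\<rho> s *\<^sub>R (x + s *\<^sub>R v))) + (\<rho> s * (u + s * z))\<^sup>2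
        = \<rho> s * \<rho> s * (c * ((x + s *\<^sub>R v) \<bullet> (x + s *\<^sub>R v)) + (u + s * z)\<^sup>2)"
      by (simp add: power2_eq_square algebra_simps)
    then show ?thesis
      using \<rho> s * by (auto simp: \<sigma>_def space_form_iff U_def)
  qed
  moreover have "\<sigma> 0 = (x, u)" by (simp add: \<sigma>_def \<rho>_def)
  moreover have "(\<sigma> has_vector_derivative (v, z)) (at 0)"
  proof -
    \<comment> \<open>\<open>\<rho>\<close> depends on the square of \<open>s\<close> only, so
      normalising does not change the velocity at 0.\<close>
    have "(\<rho> has_field_derivative 0) (at 0)"
      unfolding \<rho>_def by (auto intro!: derivative_eq_intros)
    moreover have "((\<lambda>s. (x, u) + s *\<^sub>R (v, z)) has_vector_derivative (v, z)) (at 0)"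
      by (auto intro!: derivative_eq_intros)
    ultimately have "(\<sigma> has_vector_derivative (\<rho> 0 *\<^sub>R (v, z) + 0 *\<^sub>R ((x, u) + 0 *\<^sub>R (v, z)))) (at 0)"
      unfolding \<sigma>_def by (rule has_vector_derivative_scaleR)
    then show ?thesis by (simp add: \<rho>_def)
  qed
  ultimately show thesis
    using that[of U \<sigma>] unfolding \<sigma>_def by blast
qed

text \<open>Differentiating the quadric equation gives one inclusion, the normalised lines of
  \<open>space_form_curve\<close> give the other.\<close>

lemma tangent_space_space_form:
  assumes "(x, u) \<in> space_form c"
  shows "tangent_space (space_form c) (x, u) = {(v, z). c * (x \<bullet> v) + u * z = 0}"
proof (intro set_eqI iffI)
  fix X assume X: "X \<in> tangent_space (space_form c) (x, u)"
  have "((\<lambda>(x, u). c * (x \<bullet> x) + u\<^sup>2) has_derivative (\<lambda>(v, z). 2 * (c * (x \<bullet> v) + u * z))) (at (x, u))"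
    unfolding case_prod_beta
    by (auto intro!: derivative_eq_intros simp: inner_commute algebra_simps fun_eq_iff)
  then have "(\<lambda>(v, z). 2 * (c * (x \<bullet> v) + u * z)) X = 0"
    by (rule tangent_space_level_set[OF _ _ X]) (auto simp: space_form_iff)
  then show "X \<in> {(v, z). c * (x \<bullet> v) + u * z = 0}"
    by (auto simp: case_prod_beta)
next
  fix X :: "'a amb" assume "X \<in> {(v, z). c * (x \<bullet> v) + u * z = 0}"
  then obtain v z where X: "X = (v, z)" "c * (x \<bullet> v) + u * z = 0" by auto
  obtain U \<sigma> where \<sigma>: "smooth_on_open U \<sigma>" "0 \<in> U" "\<And>s. s \<in> U \<Longrightarrow> \<sigma> s \<in> space_form c"
    "\<sigma> 0 = (x, u)" "(\<sigma> has_vector_derivative (v, z)) (at 0)"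
    using space_form_curve[OF assms X(2)] by metis
  show "X \<in> tangent_space (space_form c) (x, u)"
    unfolding X using \<sigma>
    by (intro tangent_spaceI[OF \<sigma>(1,2) _ \<sigma>(4,5)])
       (auto simp: smooth_on_open_def intro: eventually_mono[OF eventually_nhds_in_open])
qed

lemma bilinear_space_metric: "bilinear (space_metric c)"
  by (auto simp: bilinear_def linear_iff space_metric_def algebra_simps inner_add_left inner_add_right)

lemma space_metric_commute: "space_metric c X Y = space_metric c Y X"
  by (simp add: space_metric_def inner_commute)

text \<open>For c = 0 tangency forces \<open>z = 0\<close>; for c = 1 the form is Euclidean; for c =
  -1 tangency and Cauchy-Schwarz bound the square of \<open>u * z\<close> by
  \<open>(u\<^sup>2 - 1) * (v \<bullet> v)\<close>, so \<open>z\<close> is dominated by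
  \<open>v\<close>.\<close>

lemma pos_def_space_form:
  fixes p :: "('n::finite) amb"
  assumes c: "c \<in> {0, 1, -1}" and p: "p \<in> space_form c"
  shows "pos_def_on (space_metric c) (tangent_space (space_form c) p)"
proof -
  obtain x u where xu: "p = (x, u)" by (cases p)
  note T = tangent_space_space_form[OF p[unfolded xu]]
  have "subspace (tangent_space (space_form c) p)"
    using linear_subspace_kernel[of "\<lambda>X. c * (x \<bullet> fst X) + u * snd X"]
    unfolding xu T case_prod_beta by (simp add: linear_iff inner_add_right distrib_left mult.left_commute)
  moreover have "0 < space_metric c X X" if X: "X \<in> tangent_space (space_form c) p" "X \<noteq> 0" for X
  proof -
    obtain v z where vz: "X = (v, z)" by (cases X)
    have eq: "c * (x \<bullet> v) + u * z = 0" using X T by (simp add: vz xu)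
    consider "c = 0" | "c = 1" | "c = -1" using c by auto
    then show ?thesis
    proof cases
      case 1
      then have "u \<noteq> 0" using p xu by (simp add: space_form_iff)
      then have "z = 0" using eq 1 by simp
      then show ?thesis using X vz 1 by (simp add: space_metric_def zero_prod_def)
    next
      case 2
      then have "space_metric c X X = X \<bullet> X"
        by (simp add: vz space_metric_def)
      then show ?thesis using X by simp
    next
      case 3
      then have u: "u\<^sup>2 = 1 + x \<bullet> x" "u > 0" using p xu by (auto simp: space_form_iff)
      have "(u * z)\<^sup>2 = (x \<bullet> v)\<^sup>2" using eq 3 by simp
      also have "\<dots> \<le> (x \<bullet> x) * (v \<bullet> v)" by (rule Cauchy_Schwarz_ineq)
      finally have "u\<^sup>2 * z\<^sup>2 \<le> (u\<^sup>2 - 1) * (v \<bullet> v)" using u by (simp add: power_mult_distrib)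
      then have *: "v \<bullet> v \<le> u\<^sup>2 * (v \<bullet> v - z\<^sup>2)" by (simp add: algebra_simps)
      have "v \<noteq> 0"
      proof
        assume "v = 0"
        then have "z = 0" using eq u by simp
        then show False using \<open>v = 0\<close> X vz by (simp add: zero_prod_def)
      qed
      then have "0 < u\<^sup>2 * (v \<bullet> v - z\<^sup>2)"
        using * by (smt (verit) inner_gt_zero_iff)
      then show ?thesis using 3 u by (simp add: vz space_metric_def zero_less_mult_iff power2_eq_square)
    qed
  qed
  ultimately show ?thesis
    by (simp add: pos_def_on_def bilinear_space_metric space_metric_commute)
qed

lemma bilinear_product_metric: "bilinear (product_metric c)"
  by (auto simp: bilinear_def linear_iff product_metric_def space_metric_def algebra_simps
      inner_add_left inner_add_right)

lemma product_metric_commute: "product_metric c X Y = product_metric c Y X"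
  by (simp add: product_metric_def space_metric_commute mult.commute)

lemma pos_def_product_metric:
  assumes "pos_def_on (space_metric c) T" "subspace I"
  shows "pos_def_on (product_metric c) (T \<times> I)"
proof -
  have "0 < product_metric c X X" if "X \<in> T \<times> I" "X \<noteq> 0" for X
  proof (cases "fst X = 0")
    case True
    then have "snd X \<noteq> 0" using that by (simp add: prod_eq_iff)
    then show ?thesis using True by (auto simp: product_metric_def space_metric_def zero_less_mult_iff)
  next
    case False
    then have "0 < space_metric c (fst X) (fst X)" using assms that by (auto simp: pos_def_on_def)
    then show ?thesis by (simp add: product_metric_def add_pos_nonneg)
  qed
  then show ?thesis
    using assms by (auto simp: pos_def_on_def bilinear_product_metric product_metric_commute subspace_Times)
qed

lemma tangent_space_space_line:
  "tangent_space (space_line c) (q, t) = tangent_space (space_form c) q \<times> UNIV"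
  unfolding space_line_def by (rule tangent_space_Times_UNIV)

lemma tangent_space_slice:
  "tangent_space (slice c t) (q, t) = tangent_space (space_form c) q \<times> {0}"
  unfolding slice_def by (rule tangent_space_Times_singleton)

lemma pos_def_space_line:
  assumes "c \<in> {0, 1, -1}" "p \<in> space_line c"
  shows "pos_def_on (product_metric c) (tangent_space (space_line c) p)"
proof -
  obtain q t where p: "p = (q, t)" "q \<in> space_form c"
    using assms(2) by (auto simp: space_line_def)
  show ?thesis
    unfolding p tangent_space_space_line
    by (intro pos_def_product_metric pos_def_space_form assms p subspace_UNIV)
qed

lemma pos_def_slice:
  assumes "c \<in> {0, 1, -1}" "p \<in> slice c t"
  shows "pos_def_on (product_metric c) (tangent_space (slice c t) p)"
proof -
  obtain q where p: "p = (q, t)" "q \<in> space_form c"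
    using assms(2) by (auto simp: slice_def)
  show ?thesis
    unfolding p tangent_space_slice
    by (intro pos_def_product_metric pos_def_space_form assms p subspace_single_0)
qed

section \<open>Totally geodesic hypersurfaces as linear sections of the models\<close>

text \<open>For unit \<open>\<nu>\<close> this is a great hypersphere, an affine hyperplane through
  \<open>(0, 1)\<close>, or a hyperbolic hyperplane through \<open>(0, 1)\<close>, according to the
  sign of \<open>c\<close>.\<close>

definition equator :: "real \<Rightarrow> real ^ 'n::finite \<Rightarrow> 'n amb set" where
  "equator c \<nu> = {p \<in> space_form c. fst p \<bullet> \<nu> = 0}"

text \<open>The curve of \<open>space_form_curve\<close> consists of multiples of points on the line
  through \<open>(x, u)\<close> along \<open>(v, z)\<close>, and both vectors are orthogonal to
  \<open>\<nu>\<close>.\<close>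

lemma equator_curve:
  assumes p: "(x, u) \<in> equator c \<nu>" and X: "c * (x \<bullet> v) + u * z = 0" "v \<bullet> \<nu> = 0"
  obtains U \<sigma> where "smooth_on_open U \<sigma>" "0 \<in> U" "\<And>s. s \<in> U \<Longrightarrow> \<sigma> s \<in> equator c \<nu>"
    "\<sigma> 0 = (x, u)" "(\<sigma> has_vector_derivative (v, z)) (at 0)"
proof -
  have x: "(x, u) \<in> space_form c" "x \<bullet> \<nu> = 0" using p by (auto simp: equator_def)
  obtain U \<sigma> where \<sigma>: "smooth_on_open U \<sigma>" "0 \<in> U" "\<And>s. s \<in> U \<Longrightarrow> \<sigma> s \<in> space_form c"
    "\<And>s. s \<in> U \<Longrightarrow> \<exists>a. \<sigma> s = a *\<^sub>R ((x, u) + s *\<^sub>R (v, z))" "\<sigma> 0 = (x, u)"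
    "(\<sigma> has_vector_derivative (v, z)) (at 0)"
    using space_form_curve[OF x(1) X(1)] by metis
  have "\<sigma> s \<in> equator c \<nu>" if "s \<in> U" for s
    using \<sigma>(3,4)[OF that] x(2) X(2) by (auto simp: equator_def inner_add_left)
  then show thesis using that \<sigma> by blast
qed

lemma tangent_space_equator:
  assumes p: "p \<in> equator c \<nu>"
  shows "tangent_space (equator c \<nu>) p = {X \<in> tangent_space (space_form c) p. fst X \<bullet> \<nu> = 0}"
proof (intro set_eqI iffI)
  fix X assume X: "X \<in> tangent_space (equator c \<nu>) p"
  have "((\<lambda>q. fst q \<bullet> \<nu>) has_derivative (\<lambda>X. fst X \<bullet> \<nu>)) (at p)"
    by (auto intro!: derivative_eq_intros)
  then have "fst X \<bullet> \<nu> = 0"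
    by (rule tangent_space_level_set[OF _ _ X]) (auto simp: equator_def)
  moreover have "X \<in> tangent_space (space_form c) p"
    using X tangent_space_mono[of "equator c \<nu>" "space_form c" p] by (auto simp: equator_def)
  ultimately show "X \<in> {X \<in> tangent_space (space_form c) p. fst X \<bullet> \<nu> = 0}" by simp
next
  fix X assume X: "X \<in> {X \<in> tangent_space (space_form c) p. fst X \<bullet> \<nu> = 0}"
  obtain x u v z where xu: "p = (x, u)" "X = (v, z)" by (metis surj_pair)
  have "(x, u) \<in> space_form c" using p by (simp add: xu equator_def)
  from tangent_space_space_form[OF this] have "c * (x \<bullet> v) + u * z = 0" "v \<bullet> \<nu> = 0"
    using X xu by auto
  then obtain U \<sigma> where \<sigma>: "smooth_on_open U \<sigma>" "0 \<in> U" "\<And>s. s \<in> U \<Longrightarrow> \<sigma> s \<in> equator c \<nu>"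
    "\<sigma> 0 = (x, u)" "(\<sigma> has_vector_derivative (v, z)) (at 0)"
    using equator_curve[OF p[unfolded xu]] by metis
  show "X \<in> tangent_space (equator c \<nu>) p"
    unfolding xu using \<sigma>
    by (intro tangent_spaceI[OF \<sigma>(1,2) _ \<sigma>(4,5)])
       (auto simp: smooth_on_open_def intro: eventually_mono[OF eventually_nhds_in_open])
qed

lemma normal_tangent_space_form:
  assumes "p \<in> equator c \<nu>"
  shows "(\<nu>, 0) \<in> tangent_space (space_form c) p"
  using assms by (cases p) (simp add: equator_def tangent_space_space_form)

text \<open>For c = 1 radial projection maps a punctured linear hyperplane onto the equator.
  Otherwise the equator is a graph over a hyperplane of \<open>\<real>^n\<close>.\<close>

lemma connected_equator:
  fixes \<nu> :: "real ^ 'n::finite"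
  assumes c: "c \<in> {0, 1, -1}" and n: "CARD('n) \<ge> 2" and \<nu>: "\<nu> \<noteq> 0"
  shows "connected (equator c \<nu>)"
proof (cases "c = 1")
  case True
  let ?H = "{y :: 'n amb. (\<nu>, 0) \<bullet> y = 0}"
  \<comment> \<open>This dimension is n, at least 2; a punctured line would be disconnected.\<close>
  have "aff_dim ?H = int (DIM('n amb) - 1)"
    using \<nu> by (intro aff_dim_hyperplane) (simp add: zero_prod_def)
  then have "connected (?H - {0})"
    using n by (intro connected_punctured_convex convex_hyperplane) auto
  then have "connected ((\<lambda>y. (1 / norm y) *\<^sub>R y) ` (?H - {0}))"
    by (intro connected_continuous_image continuous_intros) auto
  moreover have "(\<lambda>y. (1 / norm y) *\<^sub>R y) ` (?H - {0}) = equator c \<nu>"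
  proof (intro subset_antisym subsetI)
    fix p assume "p \<in> (\<lambda>y. (1 / norm y) *\<^sub>R y) ` (?H - {0})"
    then obtain y where y: "p = (1 / norm y) *\<^sub>R y" "(\<nu>, 0) \<bullet> y = 0" "y \<noteq> 0" by blast
    then have "norm p = 1" by simp
    then have "fst p \<bullet> fst p + (snd p)\<^sup>2 = 1"
      by (cases p) (simp add: norm_Pair power2_norm_eq_inner)
    then show "p \<in> equator c \<nu>"
      using y True by (simp add: equator_def space_form_def case_prod_beta inner_prod_def inner_commute)
  next
    fix p assume p: "p \<in> equator c \<nu>"
    then have n: "norm p = 1"
      using True by (cases p) (simp add: equator_def space_form_iff norm_Pair power2_norm_eq_inner)
    moreover have "(\<nu>, 0) \<bullet> p = 0" using p by (simp add: equator_def inner_prod_def inner_commute)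
    moreover have "p \<noteq> 0" using n by auto
    ultimately show "p \<in> (\<lambda>y. (1 / norm y) *\<^sub>R y) ` (?H - {0})"
      by (intro image_eqI[of _ _ p]) auto
  qed
  ultimately show ?thesis by simp
next
  case False
  then have c0: "c \<le> 0" using c by auto
  have pos: "1 - c * (x \<bullet> x) > 0" for x :: "real ^ 'n"
    using mult_nonpos_nonneg[OF c0 inner_ge_zero[of x]] by linarith
  let ?g = "\<lambda>x :: real ^ 'n. (x, sqrt (1 - c * (x \<bullet> x)))"
  have "connected (?g ` {x. \<nu> \<bullet> x = 0})"
    by (intro connected_continuous_image continuous_intros convex_connected convex_hyperplane)
  moreover have "?g ` {x. \<nu> \<bullet> x = 0} = equator c \<nu>"
  proof (intro subset_antisym subsetI)
    fix p assume p: "p \<in> equator c \<nu>"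
    obtain x u where xu: "p = (x, u)" by (cases p)
    have "u\<^sup>2 = 1 - c * (x \<bullet> x)" "u > 0" "x \<bullet> \<nu> = 0"
      using p c0 by (auto simp: xu equator_def space_form_iff)
    then show "p \<in> ?g ` {x. \<nu> \<bullet> x = 0}"
      by (auto simp: xu inner_commute intro!: image_eqI[of _ _ x] real_sqrt_unique[symmetric])
  next
    fix p assume "p \<in> ?g ` {x. \<nu> \<bullet> x = 0}"
    then show "p \<in> equator c \<nu>"
      using pos by (auto simp: equator_def space_form_iff inner_commute less_imp_le)
  qed
  ultimately show ?thesis by simp
qed

lemma hypersurface_equator:
  assumes \<nu>: "\<nu> \<bullet> \<nu> = 1"
  shows "hypersurface (space_form c) (equator c \<nu>)"
proof (rule hypersurface_level_setI[where U = UNIV and F = "\<lambda>p. fst p \<bullet> \<nu>"])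
  show "smooth_on_open UNIV (\<lambda>p :: 'a amb. fst p \<bullet> \<nu>)"
    by (intro smooth_intros) auto
  show "equator c \<nu> = {x \<in> space_form c \<inter> UNIV. fst x \<bullet> \<nu> = 0}" by (simp add: equator_def)
  fix p assume "p \<in> equator c \<nu>"
  from normal_tangent_space_form[OF this]
  show "\<exists>D. ((\<lambda>p. fst p \<bullet> \<nu>) has_derivative D) (at p) \<and> (\<exists>X\<in>tangent_space (space_form c) p. D X \<noteq> 0)"
    using \<nu>
    by (intro exI[of _ "\<lambda>X. fst X \<bullet> \<nu>"] conjI bexI[of _ "(\<nu>, 0)"]) (auto intro!: derivative_eq_intros)
qed

text \<open>Up to sign the unit normal is the constant ambient vector \<open>(\<nu>, 0)\<close>,
  which is tangent to the model along the whole equator.\<close>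

lemma totally_geodesic_equator:
  fixes \<nu> :: "real ^ 'n::finite"
  assumes c: "c \<in> {0, 1, -1}" and n: "CARD('n) \<ge> 2" and \<nu>: "\<nu> \<bullet> \<nu> = 1"
  shows "totally_geodesic_hypersurface (space_metric c) (space_form c) (equator c \<nu>)"
proof -
  have "shape_operator (space_metric c) (space_form c) V N p X = 0"
    if "openin (top_of_set (equator c \<nu>)) V" "unit_normal (space_metric c) (space_form c) V N"
      "p \<in> V" "X \<in> tangent_space (equator c \<nu>) p" for V N p X
  proof (rule shape_operator_constant_normal[where \<nu> = "(\<nu>, 0)", OF _ _ _ _ that])
    fix q assume q: "q \<in> equator c \<nu>"
    show "pos_def_on (space_metric c) (tangent_space (space_form c) q)"
      using q by (intro pos_def_space_form c) (simp add: equator_def)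
    show "(\<nu>, 0) \<in> tangent_space (space_form c) q"
      by (rule normal_tangent_space_form[OF q])
    show "tangent_space (equator c \<nu>) q = {X \<in> tangent_space (space_form c) q. space_metric c X (\<nu>, 0) = 0}"
      using tangent_space_equator[OF q] by (simp add: space_metric_def)
  qed (simp add: space_metric_def \<nu>)
  moreover have "\<nu> \<noteq> 0" using \<nu> by auto
  ultimately show ?thesis
    using hypersurface_equator[OF \<nu>] connected_equator[OF c n]
    by (auto simp: totally_geodesic_hypersurface_def)
qed

text \<open>The normal is again a constant vector, now inside the slice, so the shape operator
  vanishes and with it the trace.\<close>

lemma minimal_equator_slice:
  fixes \<nu> :: "real ^ 'n::finite"
  assumes c: "c \<in> {0, 1, -1}" and \<nu>: "\<nu> \<bullet> \<nu> = 1"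
  shows "minimal_hypersurface (product_metric c) (slice c t) (equator c \<nu> \<times> {t})"
proof -
  let ?S = "equator c \<nu> \<times> {t}"
  have \<nu>T: "((\<nu>, 0), 0) \<in> tangent_space (slice c t) q" if "q \<in> ?S" for q
    using that normal_tangent_space_form by (auto simp: tangent_space_slice)
  have TS: "tangent_space ?S q = {X \<in> tangent_space (slice c t) q. product_metric c X ((\<nu>, 0), 0) = 0}"
    if "q \<in> ?S" for q
    using that by (auto simp: tangent_space_slice tangent_space_Times_singleton tangent_space_equator
        product_metric_def space_metric_def)
  have pd: "pos_def_on (product_metric c) (tangent_space (slice c t) q)" if "q \<in> ?S" for q
    using that by (intro pos_def_slice c) (auto simp: equator_def slice_def)
  have sub: "subspace (tangent_space ?S q)" if q: "q \<in> ?S" for q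
  proof -
    have "subspace {X. product_metric c X ((\<nu>, 0), 0) = 0}"
      by (simp add: subspace_def bilinear_lzero[OF bilinear_product_metric]
          bilinear_ladd[OF bilinear_product_metric] bilinear_lmul[OF bilinear_product_metric])
    moreover have "tangent_space ?S q = tangent_space (slice c t) q \<inter> {X. product_metric c X ((\<nu>, 0), 0) = 0}"
      using TS[OF q] by auto
    ultimately show ?thesis
      using pd[OF q] by (auto simp: pos_def_on_def intro: subspace_inter)
  qed
  have "mean_curvature (product_metric c) (slice c t) V N p = 0"
    if V: "openin (top_of_set ?S) V" and N: "unit_normal (product_metric c) (slice c t) V N" and p: "p \<in> V"
    for V N p
  proof -
    have pS: "p \<in> ?S" using V p openin_imp_subset by blast
    have "shape_operator (product_metric c) (slice c t) V N p X = 0" if "X \<in> tangent_space ?S p" for X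
      by (rule shape_operator_constant_normal[where \<nu> = "((\<nu>, 0), 0)", OF pd \<nu>T _ TS V N p that])
         (auto simp: product_metric_def space_metric_def \<nu>)
    then show ?thesis
      unfolding mean_curvature_def tangent_space_openin[OF V p]
      by (intro trace_on_eq_0 sub pS) auto
  qed
  moreover have "hypersurface (slice c t) ?S"
  proof (rule hypersurface_level_setI[where U = UNIV and F = "\<lambda>p. fst (fst p) \<bullet> \<nu>"])
    show "smooth_on_open UNIV (\<lambda>p :: 'n amb \<times> real. fst (fst p) \<bullet> \<nu>)"
      by (intro smooth_intros) auto
    show "?S = {x \<in> slice c t \<inter> UNIV. fst (fst x) \<bullet> \<nu> = 0}" by (auto simp: equator_def slice_def)
    fix p assume "p \<in> ?S"
    then show "\<exists>D. ((\<lambda>p. fst (fst p) \<bullet> \<nu>) has_derivative D) (at p) \<and> (\<exists>X\<in>tangent_space (slice c t) p. D X \<noteq> 0)"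
      using \<nu> \<nu>T
      by (intro exI[of _ "\<lambda>X. fst (fst X) \<bullet> \<nu>"] conjI bexI[of _ "((\<nu>, 0), 0)"]) (auto intro!: derivative_eq_intros)
  qed
  ultimately show ?thesis by (simp add: minimal_hypersurface_def)
qed

subsection \<open>Rotations in a plane\<close>

locale plane_rotation =
  fixes e f :: "real ^ 'n::finite"
  assumes ee: "e \<bullet> e = 1" and ff: "f \<bullet> f = 1" and ef: "e \<bullet> f = 0"
begin

definition nu :: "real \<Rightarrow> real ^ 'n" where
  "nu \<theta> = cos \<theta> *\<^sub>R e + sin \<theta> *\<^sub>R f"

definition tau :: "real \<Rightarrow> real ^ 'n" where
  "tau \<theta> = cos \<theta> *\<^sub>R f - sin \<theta> *\<^sub>R e"

text \<open>The rotation of the plane of \<open>e\<close> and \<open>f\<close> by the angle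
  \<open>\<theta>\<close>: it carries \<open>e\<close>, \<open>f\<close> to
  \<open>nu \<theta>\<close>, \<open>tau \<theta>\<close> and fixes the orthogonal
  complement.\<close>

definition rot :: "real \<Rightarrow> real ^ 'n \<Rightarrow> real ^ 'n" where
  "rot \<theta> x = x + (x \<bullet> e) *\<^sub>R (nu \<theta> - e) + (x \<bullet> f) *\<^sub>R (tau \<theta> - f)"

lemma fe: "f \<bullet> e = 0"
  using ef by (simp add: inner_commute)

lemma frame_simps [simp]:
  "nu \<theta> \<bullet> nu \<theta> = 1" "tau \<theta> \<bullet> tau \<theta> = 1" "nu \<theta> \<bullet> tau \<theta> = 0" "tau \<theta> \<bullet> nu \<theta> = 0" "nu 0 = e" "tau 0 = f"
  using sin_cos_squared_add2[of \<theta>]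
  by (simp_all add: nu_def tau_def inner_add_left inner_add_right inner_diff_left inner_diff_right
      ee ff ef fe power2_eq_square add.commute)

lemma inner_rot_basis: "rot \<theta> x \<bullet> e = cos \<theta> * (x \<bullet> e) - sin \<theta> * (x \<bullet> f)"
  "rot \<theta> x \<bullet> f = sin \<theta> * (x \<bullet> e) + cos \<theta> * (x \<bullet> f)"
  by (simp_all add: rot_def nu_def tau_def inner_add_left inner_diff_left ee ff ef fe algebra_simps)

lemma rot_0 [simp]: "rot 0 x = x"
  by (simp add: rot_def)

lemma rot_add: "rot (s + t) x = rot s (rot t x)"
proof -
  have "rot s (rot t x) = rot t x + (rot t x \<bullet> e) *\<^sub>R (nu s - e) + (rot t x \<bullet> f) *\<^sub>R (tau s - f)"
    by (simp only: rot_def[of s "rot t x"])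
  also have "\<dots> = rot (s + t) x"
    unfolding inner_rot_basis
    by (simp add: rot_def nu_def tau_def sin_add cos_add algebra_simps)
  finally show ?thesis by simp
qed

lemma rot_minus [simp]: "rot (- \<theta>) (rot \<theta> x) = x" "rot \<theta> (rot (- \<theta>) x) = x"
  by (simp_all add: rot_add[symmetric])

lemma bounded_linear_rot: "bounded_linear (rot \<theta>)"
  by (simp add: linear_conv_bounded_linear[symmetric] linear_iff rot_def inner_add_left algebra_simps)

text \<open>Rotating by \<open>\<theta>\<close> thus carries the hyperplane normal to
  \<open>nu \<alpha>\<close> to the one normal to \<open>nu (\<alpha> + \<theta>)\<close>, which is
  why screw motions preserve the helicoid.\<close>

lemma inner_rot_nu: "rot \<theta> x \<bullet> nu (\<alpha> + \<theta>) = x \<bullet> nu \<alpha>"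
proof -
  have "rot \<theta> x \<bullet> nu (\<alpha> + \<theta>)
      = (cos \<alpha> * cos \<theta> - sin \<alpha> * sin \<theta>) * (cos \<theta> * (x \<bullet> e) - sin \<theta> * (x \<bullet> f))
        + (sin \<alpha> * cos \<theta> + cos \<alpha> * sin \<theta>) * (sin \<theta> * (x \<bullet> e) + cos \<theta> * (x \<bullet> f))"
    by (simp add: nu_def inner_add_right inner_rot_basis cos_add sin_add)
  also have "\<dots> = cos \<alpha> * (x \<bullet> e) + sin \<alpha> * (x \<bullet> f)"
    using sin_cos_squared_add[of \<theta>] by algebra
  finally show ?thesis by (simp add: nu_def inner_add_right)
qed

lemma rot_inner [simp]: "rot \<theta> x \<bullet> rot \<theta> y = x \<bullet> y"
proof -
  \<comment> \<open>The angle is written \<open>0 + \<theta>\<close> so that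
    \<open>inner_rot_nu\<close> rewrites with \<open>\<alpha> = 0\<close>.\<close>
  have "rot \<theta> x \<bullet> rot \<theta> y = rot \<theta> x \<bullet> y + (y \<bullet> e) * (rot \<theta> x \<bullet> nu (0 + \<theta>) - rot \<theta> x \<bullet> e)
      + (y \<bullet> f) * (rot \<theta> x \<bullet> tau \<theta> - rot \<theta> x \<bullet> f)"
    by (simp add: rot_def[of \<theta> y] inner_add_right inner_diff_right)
  also have "rot \<theta> x \<bullet> tau \<theta> = x \<bullet> f"
    unfolding tau_def inner_diff_right inner_scaleR_right inner_rot_basis
    using sin_cos_squared_add[of \<theta>] by algebra
  also have "rot \<theta> x \<bullet> y = x \<bullet> y + (x \<bullet> e) * (nu \<theta> \<bullet> y - e \<bullet> y) + (x \<bullet> f) * (tau \<theta> \<bullet> y - f \<bullet> y)"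
    by (simp add: rot_def inner_add_left inner_diff_left)
  finally show ?thesis
    unfolding inner_rot_nu inner_rot_basis
    by (simp add: nu_def tau_def inner_add_left inner_diff_left inner_commute algebra_simps)
qed

lemma smooth_on_open_nu [smooth_intros]: "smooth_on_open U g \<Longrightarrow> smooth_on_open U (\<lambda>x. nu (g x))"
  unfolding nu_def by (intro smooth_intros) (auto simp: smooth_on_open_def)

lemma smooth_on_open_tau [smooth_intros]: "smooth_on_open U g \<Longrightarrow> smooth_on_open U (\<lambda>x. tau (g x))"
  unfolding tau_def by (intro smooth_intros) (auto simp: smooth_on_open_def)

lemma smooth_on_open_rot [smooth_intros]:
  "smooth_on_open U g \<Longrightarrow> smooth_on_open U h \<Longrightarrow> smooth_on_open U (\<lambda>x. rot (g x) (h x))"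
  unfolding rot_def by (intro smooth_intros) (auto simp: smooth_on_open_def)

lemma nu_has_derivative [derivative_intros]:
  "(g has_derivative g') (at a within S) \<Longrightarrow> ((\<lambda>x. nu (g x)) has_derivative (\<lambda>h. g' h *\<^sub>R tau (g a))) (at a within S)"
  unfolding nu_def tau_def
  by (auto intro!: derivative_eq_intros simp: algebra_simps)

lemma tau_has_derivative [derivative_intros]:
  "(g has_derivative g') (at a within S) \<Longrightarrow> ((\<lambda>x. tau (g x)) has_derivative (\<lambda>h. - g' h *\<^sub>R nu (g a))) (at a within S)"
  unfolding nu_def tau_def
  by (auto intro!: derivative_eq_intros simp: algebra_simps)

text \<open>Here \<open>k\<close> is the angular speed. As the last coordinate is left alone, one
  formula acts on all three models by linear isometries.\<close>

definition rotation :: "real \<Rightarrow> real \<Rightarrow> 'n amb \<Rightarrow> 'n amb" where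
  "rotation k s p = (rot (k * s) (fst p), snd p)"

lemma rotation_group:
  "rotation k 0 p = p" "rotation k (s + t) p = rotation k s (rotation k t p)"
  "rotation k s (rotation k (- s) p) = p" "rotation k (- s) (rotation k s p) = p"
  by (simp_all add: rotation_def distrib_left rot_add)

lemma rotation_space_form [simp]: "rotation k s p \<in> space_form c \<longleftrightarrow> p \<in> space_form c"
  by (cases p) (simp add: rotation_def space_form_iff)

lemma bounded_linear_rotation: "bounded_linear (rotation k s)"
  unfolding rotation_def
  by (intro bounded_linear_Pair bounded_linear_compose[OF bounded_linear_rot] bounded_linear_fst bounded_linear_snd)

lemma riemannian_isometry_rotation:
  "riemannian_isometry (space_metric c) (space_form c) (rotation k s)"
proof -
  let ?W = "space_form c :: 'n amb set"
  have bij: "bij_betw (rotation k s) ?W ?W"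
    by (rule bij_betw_byWitness[where f' = "rotation k (- s)"]) (auto simp: rotation_group)
  have inv: "rotation k (- s) p = inv_into ?W (rotation k s) p" if "p \<in> ?W" for p
    by (rule inv_into_f_eq[symmetric])
       (use that bij in \<open>auto simp: rotation_group bij_betw_def\<close>)
  have sm: "smooth_on_open UNIV (rotation k s)" for s
    by (intro smooth_on_open_bounded_linear bounded_linear_rotation open_UNIV)
  have "smooth_map_on ?W (rotation k s)"
    by (rule smooth_map_onI[OF sm]) auto
  moreover have "smooth_map_on ?W (inv_into ?W (rotation k s))"
    by (rule smooth_map_onI[OF sm[of "- s"]]) (auto simp: inv)
  moreover have "space_metric c (frechet_derivative (rotation k s) (at p within ?W) X)
      (frechet_derivative (rotation k s) (at p within ?W) Y) = space_metric c X Y"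
    if "X \<in> tangent_space ?W p" "Y \<in> tangent_space ?W p" for p X Y
    using that frechet_derivative_within_tangent[OF bounded_linear_imp_has_derivative[OF bounded_linear_rotation]]
    by (simp add: rotation_def space_metric_def)
  ultimately show ?thesis using bij by (simp add: riemannian_isometry_def)
qed

lemma one_parameter_isometry_group_rotation:
  "one_parameter_isometry_group (space_metric c) (space_form c) (rotation k)"
proof -
  have "smooth_on_open UNIV (\<lambda>y :: real \<times> 'n amb. rotation k (fst y) (snd y))"
    unfolding rotation_def by (intro smooth_intros) auto
  then have "smooth_map_on (UNIV \<times> space_form c) (\<lambda>(s, p). rotation k s p)"
    by (rule smooth_map_onI) (auto simp: case_prod_beta)
  then show ?thesis
    by (simp add: one_parameter_isometry_group_def riemannian_isometry_rotation rotation_group)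
qed

end

subsection \<open>Vertical helicoids\<close>

locale helicoid = plane_rotation e f for e f :: "real ^ 'n::finite" +
  fixes c l :: real
  assumes c: "c \<in> {0, 1, -1}"
begin

definition Sig :: "('n amb \<times> real) set" where
  "Sig = {p \<in> space_line c. fst (fst p) \<bullet> nu (l * snd p) = 0}"

text \<open>This is q, the displacement of x in the direction towards which the normal turns; the
  vertical coordinate is \<open>snd p\<close>.\<close>

definition height :: "'n amb \<times> real \<Rightarrow> real" where
  "height p = fst (fst p) \<bullet> tau (l * snd p)"

lemma SigE:
  assumes "p \<in> Sig"
  obtains x u t where "p = ((x, u), t)" "(x, u) \<in> space_form c" "x \<bullet> nu (l * t) = 0"
  using assms by (cases p) (auto simp: Sig_def space_line_def)

lemma Sig_slice: "Sig \<inter> slice c t = equator c (nu (l * t)) \<times> {t}"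
  by (auto simp: Sig_def space_line_def slice_def equator_def)

lemma level_function_has_derivative:
  "((\<lambda>p. fst (fst p) \<bullet> nu (l * snd p)) has_derivative
    (\<lambda>X. fst (fst X) \<bullet> nu (l * snd p) + l * height p * snd X)) (at p)"
  by (rule derivative_eq_intros nu_has_derivative[of _ _ p UNIV] | simp add: height_def algebra_simps)+

lemma normal_tangent_space_line:
  assumes "p \<in> Sig"
  shows "((nu (l * snd p), 0), r) \<in> tangent_space (space_line c) p"
  using assms by (elim SigE) (simp add: tangent_space_space_line tangent_space_space_form)

text \<open>One inclusion differentiates the defining function. For the other, a curve in a fixed
  equator is carried along by the screw motion so that its velocity becomes
  \<open>X\<close>.\<close>

lemma tangent_space_Sig:
  assumes p: "p \<in> Sig"
  shows "tangent_space Sig p =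
    {X \<in> tangent_space (space_line c) p. fst (fst X) \<bullet> nu (l * snd p) + l * height p * snd X = 0}"
proof (intro set_eqI iffI)
  fix X assume X: "X \<in> tangent_space Sig p"
  have "fst (fst X) \<bullet> nu (l * snd p) + l * height p * snd X = 0"
    by (rule tangent_space_level_set[OF level_function_has_derivative _ X]) (auto simp: Sig_def)
  moreover have "X \<in> tangent_space (space_line c) p"
    using X tangent_space_mono[of Sig "space_line c" p] by (auto simp: Sig_def)
  ultimately show "X \<in> {X \<in> tangent_space (space_line c) p.
      fst (fst X) \<bullet> nu (l * snd p) + l * height p * snd X = 0}" by simp
next
  fix X assume X: "X \<in> {X \<in> tangent_space (space_line c) p.
      fst (fst X) \<bullet> nu (l * snd p) + l * height p * snd X = 0}"
  obtain x u t where xu: "p = ((x, u), t)" "(x, u) \<in> space_form c" "x \<bullet> nu (l * t) = 0"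
    using p by (rule SigE)
  obtain v z r where vz: "X = ((v, z), r)" by (metis surj_pair)
  have eqs: "c * (x \<bullet> v) + u * z = 0" "v \<bullet> nu (l * t) + l * (x \<bullet> tau (l * t)) * r = 0"
    using X xu(2) by (simp_all add: xu(1) vz tangent_space_space_line tangent_space_space_form height_def)
  \<comment> \<open>The velocity of the rotating frame at \<open>x\<close>; what remains of \<open>v\<close> is tangent to the slice.\<close>
  define w where "w = (l * r) *\<^sub>R ((x \<bullet> e) *\<^sub>R f - (x \<bullet> f) *\<^sub>R e)"
  have w: "x \<bullet> w = 0" "w \<bullet> nu (l * t) = - l * r * (x \<bullet> tau (l * t))"
    by (simp_all add: w_def nu_def tau_def inner_add_right inner_diff_right inner_diff_left ee ff ef fe
        inner_commute[of x] algebra_simps)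
  have eq: "c * (x \<bullet> (v - w)) + u * z = 0" "(v - w) \<bullet> nu (l * t) = 0"
    using eqs w by (simp_all add: inner_diff_left inner_diff_right algebra_simps)
  have "(x, u) \<in> equator c (nu (l * t))" using xu by (simp add: equator_def)
  then obtain U \<sigma> where \<sigma>: "smooth_on_open U \<sigma>" "0 \<in> U" "\<And>s. s \<in> U \<Longrightarrow> \<sigma> s \<in> equator c (nu (l * t))"
    "\<sigma> 0 = (x, u)" "(\<sigma> has_vector_derivative (v - w, z)) (at 0)"
    using equator_curve eq by metis
  \<comment> \<open>While the curve rises by \<open>r * s\<close> it is rotated by
    \<open>l * (r * s)\<close>; \<open>inner_rot_nu\<close> keeps it in \<open>Sig\<close>, and the
    rotation adds \<open>w\<close> back to the velocity at 0.\<close>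
  define \<gamma> where "\<gamma> s = ((rot (l * (r * s)) (fst (\<sigma> s)), snd (\<sigma> s)), t + r * s)" for s
  have "open U" using \<sigma>(1) by (simp add: smooth_on_open_def)
  have "smooth_on_open U \<gamma>"
    unfolding \<gamma>_def by (intro smooth_intros \<sigma> \<open>open U\<close>)
  moreover have "\<gamma> s \<in> Sig" if "s \<in> U" for s
  proof -
    have "rot (l * (r * s)) (fst (\<sigma> s)) \<bullet> nu (l * t + l * (r * s)) = 0"
      using \<sigma>(3)[OF that] unfolding inner_rot_nu by (simp add: equator_def)
    moreover have "rotation l (r * s) (\<sigma> s) \<in> space_form c"
      using \<sigma>(3)[OF that] by (simp add: equator_def)
    ultimately show ?thesis by (simp add: Sig_def space_line_def \<gamma>_def rotation_def distrib_left)
  qed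
  then have "\<forall>\<^sub>F s in nhds 0. \<gamma> s \<in> Sig"
    using eventually_nhds_in_open[OF \<open>open U\<close> \<sigma>(2)] by (auto elim: eventually_mono)
  moreover have "\<gamma> 0 = p" by (simp add: \<gamma>_def \<sigma> xu)
  moreover have "(\<gamma> has_vector_derivative X) (at 0)"
  proof -
    have d1: "((\<lambda>s. fst (\<sigma> s)) has_vector_derivative v - w) (at 0)"
      using bounded_linear.has_vector_derivative[OF bounded_linear_fst \<sigma>(5)] by simp
    have d2: "((\<lambda>s. snd (\<sigma> s)) has_vector_derivative z) (at 0)"
      using bounded_linear.has_vector_derivative[OF bounded_linear_snd \<sigma>(5)] by simp
    have n: "((\<lambda>s. nu (l * (r * s))) has_vector_derivative (l * r) *\<^sub>R f) (at 0)"
      unfolding has_vector_derivative_def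
      by (rule derivative_eq_intros nu_has_derivative[of _ _ 0 UNIV] | simp add: algebra_simps)+
    have t: "((\<lambda>s. tau (l * (r * s))) has_vector_derivative - (l * r) *\<^sub>R e) (at 0)"
      unfolding has_vector_derivative_def
      by (rule derivative_eq_intros tau_has_derivative[of _ _ 0 UNIV] | simp add: algebra_simps)+
    have i: "((\<lambda>s. fst (\<sigma> s) \<bullet> b) has_field_derivative (v - w) \<bullet> b) (at 0)" for b
      unfolding has_real_derivative_iff_has_vector_derivative
      by (rule bounded_linear.has_vector_derivative[OF bounded_linear_inner_left d1])
    have "((\<lambda>s. rot (l * (r * s)) (fst (\<sigma> s))) has_vector_derivative v) (at 0)"
      unfolding rot_def
      by (rule has_vector_derivative_eq_rhs, (rule derivative_intros d1 n t i)+)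
         (simp add: \<sigma>(4) w_def algebra_simps)
    moreover have "((\<lambda>s. t + r * s) has_vector_derivative r) (at 0)"
      by (auto intro!: derivative_eq_intros simp: has_real_derivative_iff_has_vector_derivative[symmetric])
    ultimately show ?thesis
      unfolding \<gamma>_def vz using d2 by (intro has_vector_derivative_Pair)
  qed
  ultimately show "X \<in> tangent_space Sig p"
    using \<sigma>(2) by (intro tangent_spaceI)
qed

lemma pos_def_Sig:
  assumes p: "p \<in> Sig"
  shows "pos_def_on (product_metric c) (tangent_space Sig p)"
proof -
  have pd: "pos_def_on (product_metric c) (tangent_space (space_line c) p)"
    using p by (intro pos_def_space_line c) (simp add: Sig_def)
  have "linear (\<lambda>X :: 'n amb \<times> real. fst (fst X) \<bullet> nu (l * snd p) + l * height p * snd X)"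
    by (simp add: linear_iff inner_add_left algebra_simps)
  then have "subspace (tangent_space (space_line c) p \<inter>
      {X. fst (fst X) \<bullet> nu (l * snd p) + l * height p * snd X = 0})"
    using pd by (intro subspace_inter linear_subspace_kernel) (auto simp: pos_def_on_def)
  moreover have "tangent_space Sig p = tangent_space (space_line c) p \<inter>
      {X. fst (fst X) \<bullet> nu (l * snd p) + l * height p * snd X = 0}"
    using tangent_space_Sig[OF p] by auto
  ultimately show ?thesis
    using pos_def_on_subset[OF pd] by simp
qed

text \<open>The defining function has derivative 1 in the horizontal direction \<open>nu\<close>.
  Open pieces are allowed because the zero mean isocurved subset is one.\<close>

lemma hypersurface_open_piece:
  assumes "openin (top_of_set Sig) V"
  shows "hypersurface (space_line c) V"
proof -
  obtain U where U: "open U" "V = Sig \<inter> U" using assms by (auto simp: openin_open)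
  show ?thesis
  proof (rule hypersurface_level_setI)
    show "smooth_on_open U (\<lambda>p. fst (fst p) \<bullet> nu (l * snd p))"
      by (intro smooth_intros U)
    show "V = {x \<in> space_line c \<inter> U. fst (fst x) \<bullet> nu (l * snd x) = 0}"
      using U by (auto simp: Sig_def)
    fix p assume "p \<in> V"
    then have "((nu (l * snd p), 0), 0) \<in> tangent_space (space_line c) p"
      using U by (intro normal_tangent_space_line) simp
    then show "\<exists>D. ((\<lambda>p. fst (fst p) \<bullet> nu (l * snd p)) has_derivative D) (at p) \<and>
        (\<exists>X\<in>tangent_space (space_line c) p. D X \<noteq> 0)"
      by (intro exI[of _ "\<lambda>X. fst (fst X) \<bullet> nu (l * snd p) + l * height p * snd X"] conjI
          level_function_has_derivative) (auto intro!: bexI)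
  qed
qed

section \<open>Global properties: properness, twisting, connectedness\<close>

text \<open>The inclusion of a closed subset is proper: it pulls a compact set back to its
  intersection with \<open>Sig\<close>.\<close>

lemma properly_embedded_Sig: "properly_embedded (space_line c) Sig"
proof -
  have "closedin (top_of_set (space_line c)) Sig"
  proof -
    have "continuous_on UNIV (\<lambda>p :: 'n amb \<times> real. fst (fst p) \<bullet> nu (l * snd p))"
      unfolding nu_def by (intro continuous_intros)
    then have "closed {p :: 'n amb \<times> real. fst (fst p) \<bullet> nu (l * snd p) = 0}"
      by (intro closed_Collect_eq continuous_on_const)
    moreover have "Sig = space_line c \<inter> {p. fst (fst p) \<bullet> nu (l * snd p) = 0}" by (auto simp: Sig_def)
    ultimately show ?thesis by (auto simp: closedin_closed)
  qed
  then have "proper_map (subtopology (top_of_set (space_line c)) Sig) (top_of_set (space_line c)) id"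
    by (subst proper_map_inclusion) (auto simp: Sig_def closed_Int_compactin)
  moreover have "space_line c \<inter> Sig = Sig" by (auto simp: Sig_def)
  ultimately show ?thesis
    by (simp add: properly_embedded_def subtopology_subtopology hypersurface_open_piece)
qed

text \<open>At time s the height is \<open>a * s\<close> and the rotation angle
  \<open>l * a * s\<close>, that is, \<open>l\<close> times the height, as in the definition of
  \<open>Sig\<close>.\<close>

lemma Sig_eq_twisting:
  assumes "a \<noteq> 0"
  shows "Sig = twisting (rotation (l * a)) a (equator c e)"
proof (intro subset_antisym subsetI)
  fix y assume "y \<in> Sig"
  then obtain x u t where y: "y = ((x, u), t)" "(x, u) \<in> space_form c" "x \<bullet> nu (l * t) = 0"
    by (rule SigE)
  \<comment> \<open>The point turned back to height 0, where the section is the equator of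
    \<open>e\<close>.\<close>
  let ?p = "rotation (l * a) (- (t / a)) (x, u)"
  have "rot (l * a * (- (t / a))) x \<bullet> nu (l * t + l * a * (- (t / a))) = 0"
    unfolding inner_rot_nu by (rule y)
  then have "?p \<in> equator c e"
    using y(2) assms by (simp add: equator_def) (simp add: rotation_def)
  moreover have "y = (rotation (l * a) (t / a) ?p, a * (t / a))"
    using assms by (simp add: y(1) rotation_group)
  ultimately show "y \<in> twisting (rotation (l * a)) a (equator c e)"
    unfolding twisting_def by blast
next
  fix y assume "y \<in> twisting (rotation (l * a)) a (equator c e)"
  then obtain s p where y: "y = (rotation (l * a) s p, a * s)" "p \<in> equator c e"
    by (auto simp: twisting_def)
  have "rot (l * a * s) (fst p) \<bullet> nu (0 + l * a * s) = 0"
    using y(2) unfolding inner_rot_nu by (simp add: equator_def)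
  then show "y \<in> Sig"
    using y by (simp add: Sig_def space_line_def equator_def) (simp add: rotation_def mult.assoc)
qed

text \<open>The twisting of pitch 1 presents \<open>Sig\<close> as a continuous image of the line
  times a connected equator.\<close>

lemma connected_Sig:
  assumes "CARD('n) \<ge> 2"
  shows "connected Sig"
proof -
  let ?h = "\<lambda>y :: real \<times> 'n amb. (rotation l (fst y) (snd y), fst y)"
  have "Sig = ?h ` (UNIV \<times> equator c e)"
    using Sig_eq_twisting[of 1] by (auto simp: twisting_def image_def)
  moreover have "smooth_on_open UNIV ?h"
    unfolding rotation_def by (intro smooth_intros) auto
  then have "continuous_on (UNIV \<times> equator c e) ?h"
    using smooth_on_open_continuous_on continuous_on_subset by blast
  moreover have "connected (equator c e)"
    using ee by (intro connected_equator c assms) auto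
  ultimately show ?thesis
    by (auto intro!: connected_continuous_image connected_Times)
qed

end

subsection \<open>Mean curvature\<close>

context helicoid
begin

text \<open>Up to scaling the Riemannian unit normal is \<open>(\<nu>, l q)\<close> and the Lorentzian one is
  \<open>(\<nu>, - l q)\<close>, where \<open>q\<close> is the function \<open>height\<close>; the sign \<open>\<sigma>\<close> selects between them.\<close>

definition scale :: "real \<Rightarrow> 'n amb \<times> real \<Rightarrow> real" where
  "scale \<sigma> p = \<sigma> * (l\<^sup>2 * (height p)\<^sup>2 + \<sigma>) powr (-1/2)"

definition normal :: "real \<Rightarrow> 'n amb \<times> real \<Rightarrow> 'n amb \<times> real" where
  "normal \<sigma> p = scale \<sigma> p *\<^sub>R ((nu (l * snd p), 0), \<sigma> * l * height p)"

text \<open>Normalised to have vertical component 1; the gradient of the vertical coordinate is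
  \<open>(scale 1 p)\<^sup>2\<close> times this field.\<close>

definition grad :: "'n amb \<times> real \<Rightarrow> 'n amb \<times> real" where
  "grad p = ((- (l * height p) *\<^sub>R nu (l * snd p), 0), 1)"

text \<open>The projection of \<open>tau\<close> to the tangent space of the model: \<open>c\<close>
  times q times the position vector is subtracted, hence nothing for c = 0.\<close>

definition tau_tangent :: "'n amb \<times> real \<Rightarrow> 'n amb \<times> real" where
  "tau_tangent p = ((tau (l * snd p) - (c * height p) *\<^sub>R fst (fst p), - c * height p * snd (fst p)), 0)"

lemma scale_eq: "scale \<sigma> p = \<sigma> / sqrt (l\<^sup>2 * (height p)\<^sup>2 + \<sigma>)" if "0 < l\<^sup>2 * (height p)\<^sup>2 + \<sigma>"
  using that by (simp add: scale_def powr_minus powr_half_sqrt field_simps)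

lemma scale_square:
  assumes "0 < l\<^sup>2 * (height p)\<^sup>2 + \<sigma>" "\<sigma> \<in> {1, -1}"
  shows "(scale \<sigma> p)\<^sup>2 * (l\<^sup>2 * (height p)\<^sup>2 + \<sigma>) = 1"
  using assms by (auto simp: scale_eq power_divide)

section \<open>The covariant derivative of the two normals\<close>

text \<open>The turning of \<open>tau\<close> contributes a multiple of x \<bullet> \<nu>, which
  vanishes on \<open>Sig\<close>.\<close>

lemma height_has_derivative:
  assumes "p \<in> Sig"
  shows "(height has_derivative (\<lambda>X. fst (fst X) \<bullet> tau (l * snd p))) (at p)"
proof -
  have "fst (fst p) \<bullet> nu (l * snd p) = 0" using assms by (simp add: Sig_def)
  then show ?thesis
    unfolding height_def[abs_def]
    by - (rule derivative_eq_intros tau_has_derivative[of _ _ p UNIV] | simp)+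
qed

lemma scale_has_derivative:
  assumes "p \<in> Sig" "0 < l\<^sup>2 * (height p)\<^sup>2 + \<sigma>" "\<sigma> \<in> {1, -1}"
  shows "(scale \<sigma> has_derivative
    (\<lambda>X. (fst (fst X) \<bullet> tau (l * snd p)) * (- ((scale \<sigma> p) ^ 3) * l\<^sup>2 * height p))) (at p)"
proof -
  let ?y = "l\<^sup>2 * (height p)\<^sup>2 + \<sigma>"
  have "((\<lambda>y. \<sigma> * (l\<^sup>2 * y\<^sup>2 + \<sigma>) powr (-1/2)) has_field_derivative
      \<sigma> * (-1/2 * ?y powr (-1/2 - 1) * (l\<^sup>2 * (2 * height p)))) (at (height p))"
    using assms(2) by (auto intro!: derivative_eq_intros simp: powr_diff)
  \<comment> \<open>A sign equals its own cube, so the derivative is expressed by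
    \<open>scale\<close> again.\<close>
  moreover have "(scale \<sigma> p) ^ 3 = \<sigma> * ?y powr (-1/2 - 1)"
  proof -
    have "?y powr (-1/2 - 1) = ?y powr (-1/2) * ?y powr (-1/2) * ?y powr (-1/2)"
      unfolding powr_add[symmetric] by simp
    then show ?thesis
      using assms(3) by (auto simp: scale_def power3_eq_cube)
  qed
  ultimately have "((\<lambda>y. \<sigma> * (l\<^sup>2 * y\<^sup>2 + \<sigma>) powr (-1/2)) has_field_derivative
      - ((scale \<sigma> p) ^ 3) * l\<^sup>2 * height p) (at (height p))"
    by (simp add: algebra_simps)
  from DERIV_compose_FDERIV[OF this height_has_derivative[OF assms(1)]]
  show ?thesis by (simp add: scale_def[abs_def])
qed

text \<open>The turning of \<nu> contributes the \<open>tau\<close> term. The change of q enters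
  through the vertical component and through \<open>scale\<close>; by \<open>scale_square\<close>
  the two combine to a multiple of the same \<open>grad\<close> for both signs.\<close>

lemma normal_has_derivative:
  assumes "p \<in> Sig" "0 < l\<^sup>2 * (height p)\<^sup>2 + \<sigma>" "\<sigma> \<in> {1, -1}"
  shows "(normal \<sigma> has_derivative (\<lambda>X. (scale \<sigma> p * l) *\<^sub>R
     (snd X *\<^sub>R ((tau (l * snd p), 0), 0)
      + ((fst (fst X) \<bullet> tau (l * snd p)) * (scale \<sigma> p)\<^sup>2) *\<^sub>R grad p))) (at p)"
proof -
  define h q T n where defs: "h = scale \<sigma> p" "q = height p" "T = tau (l * snd p)" "n = nu (l * snd p)"
  have h: "h\<^sup>2 * (l\<^sup>2 * q\<^sup>2 + \<sigma>) = 1" "\<sigma> * \<sigma> = 1"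
    using scale_square[OF assms(2,3)] assms(3) by (auto simp: defs)
  have dn: "((\<lambda>p. nu (l * snd p)) has_derivative (\<lambda>X. (l * snd X) *\<^sub>R T)) (at p)"
    unfolding defs by (intro nu_has_derivative derivative_intros)
  have dh: "((\<lambda>p. \<sigma> * l * height p) has_derivative (\<lambda>X. \<sigma> * l * (fst (fst X) \<bullet> T))) (at p)"
    unfolding defs by (intro has_derivative_mult_right height_has_derivative assms)
  have "((\<lambda>p. scale \<sigma> p *\<^sub>R ((nu (l * snd p), 0 :: real), \<sigma> * l * height p)) has_derivative
    (\<lambda>X. h *\<^sub>R (((l * snd X) *\<^sub>R T, 0), \<sigma> * l * (fst (fst X) \<bullet> T))
      + ((fst (fst X) \<bullet> T) * (- (h ^ 3) * l\<^sup>2 * q)) *\<^sub>R ((n, 0), \<sigma> * l * q))) (at p)"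
    using has_derivative_scaleR[OF scale_has_derivative[OF assms]
        has_derivative_Pair[OF has_derivative_Pair[OF dn has_derivative_const[where c = 0]] dh]]
    by (simp add: defs)
  moreover have "h *\<^sub>R (((l * snd X) *\<^sub>R T, 0), \<sigma> * l * (fst (fst X) \<bullet> T))
      + ((fst (fst X) \<bullet> T) * (- (h ^ 3) * l\<^sup>2 * q)) *\<^sub>R ((n, 0), \<sigma> * l * q)
    = (h * l) *\<^sub>R (snd X *\<^sub>R ((T, 0), 0) + ((fst (fst X) \<bullet> T) * h\<^sup>2) *\<^sub>R ((- (l * q) *\<^sub>R n, 0), 1))" for X :: "'n amb \<times> real"
  proof -
    define s where "s = fst (fst X) \<bullet> T"
    \<comment> \<open>The vertical components agree because h^2 (l^2 q^2 + \<sigma>) = 1 turns 1 -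
      h^2 l^2 q^2 into h^2 \<sigma>.\<close>
    have "h * (\<sigma> * l * s) + s * (- (h ^ 3) * l\<^sup>2 * q) * (\<sigma> * l * q) = h * l * (s * h\<^sup>2)"
      using h by algebra
    then show ?thesis
      unfolding s_def[symmetric] by (simp add: algebra_simps power2_eq_square power3_eq_cube)
  qed
  ultimately show ?thesis
    by (simp add: normal_def[abs_def] grad_def defs)
qed

lemma grad_tangent: "p \<in> Sig \<Longrightarrow> grad p \<in> tangent_space Sig p"
  by (simp add: tangent_space_Sig) (auto elim!: SigE
      simp: grad_def tangent_space_space_line tangent_space_space_form)

lemma tau_tangent_line:
  assumes "p \<in> Sig"
  shows "tau_tangent p \<in> tangent_space (space_line c) p"
proof -
  obtain x u t where p: "p = ((x, u), t)" "(x, u) \<in> space_form c" using assms by (rule SigE)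
  define q where "q = x \<bullet> tau (l * t)"
  have "c * (x \<bullet> (tau (l * t) - (c * q) *\<^sub>R x)) - u * (c * q * u) = c * q * (1 - (c * (x \<bullet> x) + u\<^sup>2))"
    by (simp add: inner_diff_right q_def[symmetric] power2_eq_square algebra_simps)
  also have "\<dots> = 0" using p by (simp add: space_form_iff)
  finally show ?thesis
    using p by (simp add: tau_tangent_def height_def q_def tangent_space_space_line tangent_space_space_form)
qed

lemma tau_tangent_tangent: "p \<in> Sig \<Longrightarrow> tau_tangent p \<in> tangent_space Sig p"
  using tau_tangent_line by (simp add: tangent_space_Sig) (auto elim!: SigE simp: tau_tangent_def inner_diff_left)

lemma tau_tangent_orthogonal:
  assumes "p \<in> Sig" "Z \<in> tangent_space (space_line c) p"
  shows "product_metric c (((tau (l * snd p), 0), 0) - tau_tangent p) Z = 0"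
proof -
  obtain x u t where p: "p = ((x, u), t)" "(x, u) \<in> space_form c" using assms(1) by (rule SigE)
  obtain v z r where Z: "Z = ((v, z), r)" by (metis surj_pair)
  have "c * (x \<bullet> v) + u * z = 0"
    using assms(2) p by (simp add: Z tangent_space_space_line tangent_space_space_form)
  \<comment> \<open>For c = 1 or c = -1 the factor \<open>c * c\<close> is 1 and the bracket is the
    tangency equation; for c = 0 the bracket is zero outright.\<close>
  moreover have "product_metric c (((tau (l * snd p), 0), 0) - tau_tangent p) Z
      = height p * (c * (x \<bullet> v) + c * c * (u * z))"
    by (simp add: p Z product_metric_def space_metric_def tau_tangent_def algebra_simps)
  ultimately show ?thesis using c by auto
qed

text \<open>Projecting the derivative replaces \<open>tau\<close> by \<open>tau_tangent\<close>,
  while \<open>grad\<close> is already tangent. \<open>Y\<close> is matched with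
  \<open>normal\<close> on \<open>V\<close> only, so the Lorentzian normal of a spacelike piece is
  covered as well.\<close>

lemma levi_civita_normal:
  assumes V: "openin (top_of_set Sig) V" and p: "p \<in> V" and X: "X \<in> tangent_space V p"
    and \<sigma>: "\<sigma> \<in> {1, -1}" and pos: "0 < l\<^sup>2 * (height p)\<^sup>2 + \<sigma>"
    and Y: "\<And>q. q \<in> V \<Longrightarrow> Y q = normal \<sigma> q"
  shows "levi_civita (product_metric c) (space_line c) V Y p X = (scale \<sigma> p * l) *\<^sub>R
     (snd X *\<^sub>R tau_tangent p + ((fst (fst X) \<bullet> tau (l * snd p)) * (scale \<sigma> p)\<^sup>2) *\<^sub>R grad p)"
proof -
  have pS: "p \<in> Sig" using V p openin_imp_subset by blast
  let ?T = "tangent_space (space_line c) p"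
  let ?\<tau> = "((tau (l * snd p), 0), 0)"
  let ?w = "(fst (fst X) \<bullet> tau (l * snd p)) * (scale \<sigma> p)\<^sup>2"
  have pd: "pos_def_on (product_metric c) ?T"
    using pS by (intro pos_def_space_line c) (simp add: Sig_def)
  have "(Y has_derivative (\<lambda>X. (scale \<sigma> p * l) *\<^sub>R (snd X *\<^sub>R ?\<tau>
      + ((fst (fst X) \<bullet> tau (l * snd p)) * (scale \<sigma> p)\<^sup>2) *\<^sub>R grad p))) (at p within V)"
    by (rule has_derivative_transform[OF p Y has_derivative_at_withinI[OF normal_has_derivative[OF pS pos \<sigma>]]])
  then have fd: "frechet_derivative Y (at p within V) X = (scale \<sigma> p * l) *\<^sub>R (snd X *\<^sub>R ?\<tau> + ?w *\<^sub>R grad p)"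
    using X by (rule frechet_derivative_within_tangent)
  show ?thesis
  proof (rule levi_civita_eq[OF pd fd])
    have "grad p \<in> ?T" using grad_tangent[OF pS] tangent_space_Sig[OF pS] by auto
    then show "(scale \<sigma> p * l) *\<^sub>R (snd X *\<^sub>R tau_tangent p + ?w *\<^sub>R grad p) \<in> ?T"
      using pd tau_tangent_line[OF pS] by (simp add: pos_def_on_def subspace_add subspace_scale)
    fix Z assume Z: "Z \<in> ?T"
    have "(scale \<sigma> p * l) *\<^sub>R (snd X *\<^sub>R ?\<tau> + ?w *\<^sub>R grad p)
        - (scale \<sigma> p * l) *\<^sub>R (snd X *\<^sub>R tau_tangent p + ?w *\<^sub>R grad p)
      = (scale \<sigma> p * l * snd X) *\<^sub>R (?\<tau> - tau_tangent p)"
      by (simp only: scaleR_add_right scaleR_diff_right scaleR_scaleR) simp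
    then show "product_metric c ((scale \<sigma> p * l) *\<^sub>R (snd X *\<^sub>R ?\<tau> + ?w *\<^sub>R grad p)
        - (scale \<sigma> p * l) *\<^sub>R (snd X *\<^sub>R tau_tangent p + ?w *\<^sub>R grad p)) Z = 0"
      using tau_tangent_orthogonal[OF pS Z] by (simp add: bilinear_lmul[OF bilinear_product_metric])
  qed
qed

text \<open>The shape operator is a sum of two rank one maps, each of which is nilpotent: \<open>tau_tangent\<close>
  is horizontal and the horizontal part of \<open>grad\<close> is orthogonal to \<open>\<tau>\<close>.\<close>

lemma trace_levi_civita_normal:
  assumes V: "openin (top_of_set Sig) V" and p: "p \<in> V"
    and \<sigma>: "\<sigma> \<in> {1, -1}" and pos: "0 < l\<^sup>2 * (height p)\<^sup>2 + \<sigma>"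
    and Y: "\<And>q. q \<in> V \<Longrightarrow> Y q = normal \<sigma> q"
  shows "trace_on (tangent_space V p) (\<lambda>X. - levi_civita (product_metric c) (space_line c) V Y p X) = 0"
proof -
  have pS: "p \<in> Sig" using V p openin_imp_subset by blast
  have TV: "tangent_space V p = tangent_space Sig p" by (rule tangent_space_openin[OF V p])
  have sub: "subspace (tangent_space V p)" using pos_def_Sig[OF pS] by (simp add: TV pos_def_on_def)
  let ?G = "(- scale \<sigma> p * l) *\<^sub>R tau_tangent p" and ?H = "(- scale \<sigma> p * l * (scale \<sigma> p)\<^sup>2) *\<^sub>R grad p"
  have "trace_on (tangent_space V p) (\<lambda>X. - levi_civita (product_metric c) (space_line c) V Y p X)
      = snd ?G + fst (fst ?H) \<bullet> tau (l * snd p)"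
  proof (rule trace_on_rank_two[OF sub, where \<alpha> = snd and G = ?G and H = ?H
        and \<beta> = "\<lambda>X. fst (fst X) \<bullet> tau (l * snd p)"])
    show "linear (snd :: 'n amb \<times> real \<Rightarrow> real)" by (rule linear_snd)
    show "linear (\<lambda>X :: 'n amb \<times> real. fst (fst X) \<bullet> tau (l * snd p))"
      by (simp add: linear_iff inner_add_left)
    show "?G \<in> tangent_space V p" "?H \<in> tangent_space V p"
      using sub grad_tangent[OF pS] tau_tangent_tangent[OF pS] by (simp_all add: TV subspace_scale subspace_neg)
    fix X assume X: "X \<in> tangent_space V p"
    show "- levi_civita (product_metric c) (space_line c) V Y p X
        = snd X *\<^sub>R ?G + (fst (fst X) \<bullet> tau (l * snd p)) *\<^sub>R ?H"
      using levi_civita_normal[OF V p X \<sigma> pos, of Y] Y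
      by (simp add: algebra_simps)
  qed
  then show ?thesis by (simp add: tau_tangent_def grad_def)
qed

section \<open>Angle, normals and the gradient of the vertical coordinate\<close>

lemma angle_normal: "angle c (normal 1) p = scale 1 p * l * height p"
  by (simp add: angle_def normal_def d_t_def product_metric_def space_metric_def)

text \<open>With \<open>?y\<close> denoting l^2 q^2, twice the squared angle minus 1 is
  \<open>(?y - 1) / (?y + 1)\<close>. The minus sign of the Lorentzian factor is the leading
  \<sigma> in \<open>scale\<close>.\<close>

lemma lorentz_normal_normal:
  assumes "1 < l\<^sup>2 * (height p)\<^sup>2"
  shows "lorentz_normal c (normal 1) p = normal (-1) p"
proof -
  let ?y = "l\<^sup>2 * (height p)\<^sup>2"
  have pos: "?y + 1 > 0" "?y - 1 > 0" using assms by auto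
  have s: "scale 1 p = 1 / sqrt (?y + 1)" "scale (-1) p = - 1 / sqrt (?y - 1)"
    using pos by (simp_all add: scale_eq)
  have "2 * (angle c (normal 1) p)\<^sup>2 - 1 = (?y - 1) / (?y + 1)"
    using pos by (simp add: angle_normal s power_mult_distrib power_divide field_simps)
  then have "- 1 / sqrt (2 * (angle c (normal 1) p)\<^sup>2 - 1) * scale 1 p = scale (-1) p"
    using pos by (simp add: s real_sqrt_divide)
  moreover have "normal 1 p - (2 * angle c (normal 1) p) *\<^sub>R d_t
      = scale 1 p *\<^sub>R ((nu (l * snd p), 0), -1 * l * height p)"
    by (simp add: normal_def angle_normal d_t_def)
  ultimately show ?thesis
    unfolding lorentz_normal_def normal_def[of "-1"] by (metis scaleR_scaleR)
qed

lemma unit_normal_open_piece: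
  assumes V: "openin (top_of_set Sig) V"
  shows "unit_normal (product_metric c) (space_line c) V (normal 1)"
proof -
  have pos: "0 < l\<^sup>2 * y\<^sup>2 + 1" for y :: real
    by (simp add: add_nonneg_pos)
  have "smooth_on_open UNIV (normal 1)"
    unfolding normal_def scale_def height_def by (intro smooth_intros) (auto simp: pos)
  then have "smooth_map_on V (normal 1)" by (rule smooth_map_onI) auto
  moreover have "normal 1 p \<in> tangent_space (space_line c) p \<and> product_metric c (normal 1 p) (normal 1 p) = 1 \<and>
      (\<forall>X\<in>tangent_space V p. product_metric c (normal 1 p) X = 0)" if p: "p \<in> V" for p
  proof (intro conjI ballI)
    have pS: "p \<in> Sig" using V p openin_imp_subset by blast
    have "subspace (tangent_space (space_line c) p)"
      using pos_def_space_line[OF c, of p] pS by (simp add: Sig_def pos_def_on_def)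
    then show "normal 1 p \<in> tangent_space (space_line c) p"
      unfolding normal_def by (intro subspace_scale normal_tangent_space_line pS)
    have "product_metric c (normal 1 p) (normal 1 p) = (scale 1 p)\<^sup>2 * (l\<^sup>2 * (height p)\<^sup>2 + 1)"
      by (simp add: normal_def product_metric_def space_metric_def power2_eq_square algebra_simps)
    then show "product_metric c (normal 1 p) (normal 1 p) = 1"
      using scale_square[of p 1] pos by simp
    fix X assume "X \<in> tangent_space V p"
    then have "fst (fst X) \<bullet> nu (l * snd p) + l * height p * snd X = 0"
      using tangent_space_Sig[OF pS] by (simp add: tangent_space_openin[OF V p])
    moreover have "product_metric c (normal 1 p) X
        = scale 1 p * (fst (fst X) \<bullet> nu (l * snd p) + l * height p * snd X)"
      by (simp add: normal_def product_metric_def space_metric_def inner_commute algebra_simps)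
    ultimately show "product_metric c (normal 1 p) X = 0" by simp
  qed
  ultimately show ?thesis by (simp add: unit_normal_def)
qed

text \<open>On tangent vectors the \<nu>-component is -l q times the vertical one, so pairing with
  \<open>grad\<close> multiplies the vertical component by l^2 q^2 + 1, which the factor
  cancels.\<close>

lemma gradient_Sig:
  assumes p: "p \<in> Sig"
  shows "gradient (product_metric c) Sig snd p = (scale 1 p)\<^sup>2 *\<^sub>R grad p"
proof (rule gradient_eq[OF pos_def_Sig[OF p]])
  show "(snd has_derivative snd) (at p within Sig)"
    by (intro bounded_linear_imp_has_derivative bounded_linear_snd)
  show "(scale 1 p)\<^sup>2 *\<^sub>R grad p \<in> tangent_space Sig p"
    using pos_def_Sig[OF p] grad_tangent[OF p] by (simp add: pos_def_on_def subspace_scale)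
  fix X assume "X \<in> tangent_space Sig p"
  then have X: "fst (fst X) \<bullet> nu (l * snd p) = - (l * height p * snd X)"
    using tangent_space_Sig[OF p] by simp
  have "product_metric c ((scale 1 p)\<^sup>2 *\<^sub>R grad p) X
      = (scale 1 p)\<^sup>2 * (- (l * height p) * (fst (fst X) \<bullet> nu (l * snd p)) + snd X)"
    by (simp add: grad_def product_metric_def space_metric_def inner_commute algebra_simps)
  also have "\<dots> = (scale 1 p)\<^sup>2 * (l\<^sup>2 * (height p)\<^sup>2 + 1) * snd X"
    by (simp add: X power2_eq_square algebra_simps)
  also have "\<dots> = snd X"
    using scale_square[of p 1] by (simp add: add_nonneg_pos)
  finally show "product_metric c ((scale 1 p)\<^sup>2 *\<^sub>R grad p) X = snd X" .
qed

text \<open>\<nu> is orthogonal to \<tau>, which removes the \<open>grad\<close> term of the shape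
  operator; what remains is a multiple of \<open>tau_tangent\<close>, orthogonal to
  \<open>grad\<close> as x and \<tau> are orthogonal to \<nu>.\<close>

lemma shape_operator_gradient:
  assumes p: "p \<in> Sig"
  defines "G \<equiv> gradient (product_metric c) Sig snd p"
  shows "product_metric c (shape_operator (product_metric c) (space_line c) Sig (normal 1) p G) G = 0"
proof -
  have G: "G = (scale 1 p)\<^sup>2 *\<^sub>R grad p" unfolding G_def by (rule gradient_Sig[OF p])
  have "G \<in> tangent_space Sig p"
    using pos_def_Sig[OF p] grad_tangent[OF p] by (simp add: G pos_def_on_def subspace_scale)
  then have "shape_operator (product_metric c) (space_line c) Sig (normal 1) p G
      = - (scale 1 p * l) *\<^sub>R (snd G *\<^sub>R tau_tangent p
        + ((fst (fst G) \<bullet> tau (l * snd p)) * (scale 1 p)\<^sup>2) *\<^sub>R grad p)"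
    unfolding shape_operator_def
    using levi_civita_normal[of Sig p G 1 "normal 1"] p by (simp add: add_nonneg_pos)
  also have "fst (fst G) \<bullet> tau (l * snd p) = 0" by (simp add: G grad_def)
  finally have "shape_operator (product_metric c) (space_line c) Sig (normal 1) p G
      = - (scale 1 p * l * snd G) *\<^sub>R tau_tangent p" by simp
  moreover have "product_metric c (tau_tangent p) (grad p) = 0"
    using p by (simp add: Sig_def tau_tangent_def grad_def product_metric_def space_metric_def inner_diff_left)
  ultimately show ?thesis
    by (simp add: G bilinear_lmul[OF bilinear_product_metric] bilinear_rmul[OF bilinear_product_metric]
      bilinear_lneg[OF bilinear_product_metric])
qed

text \<open>Witnesses with q = 0 and q = 1. The coordinate \<open>sqrt (1 - c)\<close>, namely 1, 0
  or the root of 2 for c = 0, 1, -1, puts the unit vector \<open>f\<close> on the model.\<close>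

lemma base_points:
  "((0, 1), 0) \<in> Sig" "height ((0, 1), 0) = 0"
  "((f, sqrt (1 - c)), 0) \<in> Sig" "height ((f, sqrt (1 - c)), 0) = 1"
  using c by (auto simp: Sig_def space_line_def space_form_iff height_def ff fe)

lemma vertical_helicoid_Sig:
  assumes n: "CARD('n) \<ge> 2" and l: "l \<noteq> 0"
  shows "vertical_helicoid c Sig"
proof -
  have S: "openin (top_of_set Sig) Sig" by simp
  \<comment> \<open>The squared angle is 1 minus the square of \<open>scale 1 p\<close>, which does
    not vanish.\<close>
  have "(angle c (normal 1) p)\<^sup>2 \<noteq> 1" for p
  proof -
    have "(angle c (normal 1) p)\<^sup>2 = (scale 1 p)\<^sup>2 * (l\<^sup>2 * (height p)\<^sup>2)"
      by (simp add: angle_normal power_mult_distrib)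
    moreover have "(scale 1 p)\<^sup>2 * (l\<^sup>2 * (height p)\<^sup>2) + (scale 1 p)\<^sup>2 = 1"
      using scale_square[of p 1] by (simp add: add_nonneg_pos distrib_left)
    ultimately show ?thesis
      using scale_square[of p 1] by (auto simp: add_nonneg_pos)
  qed
  \<comment> \<open>The angle is zero where q = 0 and a nonzero multiple of \<open>scale\<close>
    where q = 1.\<close>
  moreover have "\<not> angle c (normal 1) constant_on Sig"
  proof
    assume "angle c (normal 1) constant_on Sig"
    then have "angle c (normal 1) ((0, 1), 0) = angle c (normal 1) ((f, sqrt (1 - c)), 0)"
      using base_points by (auto simp: constant_on_def)
    then have "scale 1 ((f, sqrt (1 - c)), 0) = 0"
      using l by (simp add: angle_normal base_points)
    then show False
      using scale_square[of "((f, sqrt (1 - c)), 0)" 1] by (simp add: add_nonneg_pos)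
  qed
  moreover have "minimal_hypersurface (product_metric c) (slice c t) (Sig \<inter> slice c t)" for t
    unfolding Sig_slice by (intro minimal_equator_slice c) simp
  ultimately show ?thesis
    unfolding vertical_helicoid_def Let_def
    using hypersurface_open_piece[OF S] connected_Sig[OF n] unit_normal_open_piece[OF S] shape_operator_gradient
    by blast
qed

section \<open>The spacelike zero mean isocurved part\<close>

text \<open>Horizontally, a tangent vector splits into its \<nu>-part and an orthogonal remainder of
  nonnegative square. The \<nu>-part alone has square l^2 q^2 r^2, exceeding r^2 unless r = 0, where
  positivity on the model suffices.\<close>

lemma spacelike_piece:
  assumes V: "openin (top_of_set Sig) V" and big: "\<And>p. p \<in> V \<Longrightarrow> 1 < l\<^sup>2 * (height p)\<^sup>2"
  shows "spacelike c V"
  unfolding spacelike_def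
proof (intro ballI impI)
  fix p X assume p: "p \<in> V" and X: "X \<in> tangent_space V p" "X \<noteq> 0"
  have pS: "p \<in> Sig" using V p openin_imp_subset by blast
  obtain x u t where xu: "p = ((x, u), t)" "(x, u) \<in> space_form c" "x \<bullet> nu (l * t) = 0"
    using pS by (rule SigE)
  obtain v z r where vz: "X = ((v, z), r)" by (metis surj_pair)
  define b where "b = v \<bullet> nu (l * t)"
  have "X \<in> tangent_space Sig p" using X by (simp add: tangent_space_openin[OF V p])
  then have eqs: "c * (x \<bullet> v) + u * z = 0" "b = - (l * height p * r)"
    using tangent_space_Sig[OF pS] xu(2)
    by (auto simp: xu(1) vz b_def tangent_space_space_line tangent_space_space_form)
  have pd: "pos_def_on (space_metric c) (tangent_space (space_form c) (x, u))"
    by (rule pos_def_space_form[OF c xu(2)])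
  have nonneg: "0 \<le> space_metric c Y Y" if "Y \<in> tangent_space (space_form c) (x, u)" for Y
    using pd that by (metis bilinear_lzero less_imp_le order_refl pos_def_on_def)
  have "(v - b *\<^sub>R nu (l * t), z) \<in> tangent_space (space_form c) (x, u)"
    using eqs xu by (simp add: tangent_space_space_form inner_add_right inner_diff_right)
  from nonneg[OF this] have ge: "b\<^sup>2 \<le> space_metric c (v, z) (v, z)"
    by (simp add: space_metric_def inner_diff_left inner_diff_right b_def inner_commute power2_eq_square)
  have "0 < space_metric c (v, z) (v, z) - r\<^sup>2"
  proof (cases "r = 0")
    case True
    then have "(v, z) \<noteq> 0" using X(2) by (auto simp: vz zero_prod_def)
    then show ?thesis
      using pd eqs xu True by (auto simp: pos_def_on_def tangent_space_space_form)
  next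
    case False
    have "r\<^sup>2 < l\<^sup>2 * (height p)\<^sup>2 * r\<^sup>2"
      using mult_strict_right_mono[OF big[OF p], of "r\<^sup>2"] False by simp
    also have "\<dots> = b\<^sup>2" by (simp add: eqs power_mult_distrib)
    finally show ?thesis using ge by simp
  qed
  then show "0 < lorentz_metric c X X"
    by (simp add: lorentz_metric_def vz power2_eq_square)
qed

text \<open>The two mean curvatures are the cases \<sigma> = 1 and \<sigma> = -1 of
  \<open>trace_levi_civita_normal\<close>; in the second, \<open>big\<close> makes the radicand l^2
  q^2 - 1 positive.\<close>

lemma zero_mean_isocurved_piece:
  assumes V: "openin (top_of_set Sig) V" and big: "\<And>p. p \<in> V \<Longrightarrow> 1 < l\<^sup>2 * (height p)\<^sup>2"
  shows "zero_mean_isocurved c V"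
proof -
  have "mean_curvature (product_metric c) (space_line c) V (normal 1) p = 0" if p: "p \<in> V" for p
    using trace_levi_civita_normal[OF V p, of 1 "normal 1"]
    by (simp add: mean_curvature_def shape_operator_def[abs_def] add_nonneg_pos)
  moreover have "lorentz_mean_curvature c V (normal 1) p = 0" if p: "p \<in> V" for p
    using trace_levi_civita_normal[OF V p, of "-1" "lorentz_normal c (normal 1)"] big
    by (simp add: lorentz_mean_curvature_def lorentz_shape_operator_def[abs_def] lorentz_normal_normal p)
  ultimately show ?thesis
    using hypersurface_open_piece[OF V] spacelike_piece[OF V big] unit_normal_open_piece[OF V]
    unfolding zero_mean_isocurved_def by blast
qed

lemma ex_zero_mean_isocurved_piece:
  assumes "1 < l\<^sup>2"
  shows "\<exists>V. V \<noteq> {} \<and> openin (top_of_set Sig) V \<and> zero_mean_isocurved c V"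
proof -
  let ?U = "{p. 1 < l\<^sup>2 * (height p)\<^sup>2}"
  have "open ?U"
    unfolding height_def tau_def by (intro open_Collect_less continuous_intros)
  then have V: "openin (top_of_set Sig) (Sig \<inter> ?U)" by (rule openin_open_Int)
  \<comment> \<open>Here q = 1, so the defining inequality of \<open>?U\<close> reduces to the
    assumption on \<open>l\<close>.\<close>
  have "((f, sqrt (1 - c)), 0) \<in> Sig \<inter> ?U"
    using base_points assms by simp
  moreover have "zero_mean_isocurved c (Sig \<inter> ?U)"
    by (rule zero_mean_isocurved_piece[OF V]) simp
  ultimately show ?thesis
    using V by (intro exI[of _ "Sig \<inter> ?U"]) auto
qed

end

section \<open>The two-parameter family\<close>

theorem theorem3:
  fixes c :: real
  assumes "c \<in> {0, 1, -1}"
    and "CARD('n::finite) \<ge> 2"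
  shows "\<exists>(\<Sigma> :: real \<Rightarrow> real \<Rightarrow> ('n amb \<times> real) set)
           (\<Gamma> :: real \<Rightarrow> real \<Rightarrow> 'n amb \<Rightarrow> 'n amb) (\<Sigma>\<^sub>0 :: 'n amb set).
    totally_geodesic_hypersurface (space_metric c) (space_form c) \<Sigma>\<^sub>0 \<and>
    (\<forall>k>0. one_parameter_isometry_group (space_metric c) (space_form c) (\<Gamma> k)) \<and>
    (\<forall>a>0. \<forall>k>0.
       properly_embedded (space_line c) (\<Sigma> a k) \<and>
       vertical_helicoid c (\<Sigma> a k) \<and>
       (\<forall>t. transversal_slice c (\<Sigma> a k) t \<longrightarrow>
          (\<exists>T. totally_geodesic_hypersurface (space_metric c) (space_form c) T \<and>
               \<Sigma> a k \<inter> slice c t = T \<times> {t})) \<and>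
       \<Sigma> a k = twisting (\<Gamma> k) a \<Sigma>\<^sub>0) \<and>
    (\<forall>a>0. \<exists>k>0. \<exists>V. V \<noteq> {} \<and> openin (top_of_set (\<Sigma> a k)) V \<and> zero_mean_isocurved c V)"
proof -
  obtain i j :: 'n where ij: "i \<noteq> j"
    using assms(2) card_le_Suc0_iff_eq[of "UNIV :: 'n set"] by auto
  define e f where ef: "e = (axis i 1 :: real ^ 'n)" "f = (axis j 1 :: real ^ 'n)"
  interpret plane_rotation e f
    by unfold_locales (use ij in \<open>simp_all add: ef inner_axis_axis\<close>)
  have hel: "helicoid e f c"
    by unfold_locales (rule assms)
  \<comment> \<open>The rate \<open>k / a\<close> gives the angle \<open>k * s\<close> at height
    \<open>a * s\<close>, so the group depends on \<open>k\<close> alone and one initial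
    hypersurface serves all parameters.\<close>
  let ?\<Sigma> = "\<lambda>a k. helicoid.Sig e f c (k / a)"
  show ?thesis
  proof (rule exI[of _ ?\<Sigma>], rule exI[of _ rotation], rule exI[of _ "equator c e"], intro conjI allI impI)
    show "totally_geodesic_hypersurface (space_metric c) (space_form c) (equator c e)"
      by (intro totally_geodesic_equator assms ee)
    show "one_parameter_isometry_group (space_metric c) (space_form c) (rotation k)" for k
      by (rule one_parameter_isometry_group_rotation)
    fix a :: real assume a: "0 < a"
    \<comment> \<open>The choice \<open>k = 2 * a\<close> makes the rate 2, beyond the threshold 1
      needed where q = 1.\<close>
    have "1 < (2 * a / a)\<^sup>2" using a by simp
    then show "\<exists>k>0. \<exists>V. V \<noteq> {} \<and> openin (top_of_set (?\<Sigma> a k)) V \<and> zero_mean_isocurved c V"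
      using helicoid.ex_zero_mean_isocurved_piece[OF hel, of "2 * a / a"] a by (intro exI[of _ "2 * a"]) simp
    fix k :: real assume k: "0 < k"
    show "properly_embedded (space_line c) (?\<Sigma> a k)"
      by (rule helicoid.properly_embedded_Sig[OF hel])
    show "vertical_helicoid c (?\<Sigma> a k)"
      using a k by (intro helicoid.vertical_helicoid_Sig[OF hel] assms) simp
    show "?\<Sigma> a k = twisting (rotation k) a (equator c e)"
      using helicoid.Sig_eq_twisting[OF hel, of a "k / a"] a by simp
    show "\<exists>T. totally_geodesic_hypersurface (space_metric c) (space_form c) T \<and> ?\<Sigma> a k \<inter> slice c t = T \<times> {t}" for t
      unfolding helicoid.Sig_slice[OF hel]
      by (intro exI[of _ "equator c (nu (k / a * t))"] conjI totally_geodesic_equator assms) simp_all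
  qed
qed

end
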